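(* Let $(\Omega,\mathcal F,\mathbb P)$ be a standard probability space, $\theta:\Omega\to\Omega$ an invertible, bimeasurable, measure-preserving transformation, $H$ a real separable Hilbert space, and $\mathscr H=L^2(\Omega;H)$. Let $S\subset\mathbb Z$ be finite, $R=S\cup(-S)$, let $O\subset\mathscr H$ be a convex open set, and let $F:O\to\mathscr H$ be a regular $S$-memory field with derivative coefficients $A_k[u]$. Assume $\mathbb P\{\omega:\theta^k\omega=\theta^\ell\omega\}=0$ for all $k,\ell\in R$ with $k\neq\ell$. Then the following are equivalent: (i) $F$ is potential; (ii) $DF(u)$ is self-adjoint for every $u\in O$; (iii) for every $u\in O$, every $k\in R$, and a.e. $\omega$, $$A_k[u](\omega)=A_{-k}[u](\theta^k\omega)^*.$$ When these conditions hold, for any fixed $u_0\in O$ and any constant $C\in\mathbb R$, a potential of $F$ is given by $$E(u)=C+\int_0^1\langle F(u_0+t(u-u_0)),u-u_0\rangle\,dt,\qquad u\in O.$$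
   Context: $(U^ku)(\omega)=u(\theta^k\omega)$ for $k\in\mathbb Z$, $u\in\mathscr H$. $\mathcal M_s^\infty(\Omega;\mathcal L(H))$ denotes the fields $A:\Omega\to\mathcal L(H)$ (bounded linear operators on $H$) such that $\omega\mapsto A(\omega)v$ is strongly measurable for every $v\in H$ and $\operatorname{ess\,sup}_\omega\|A(\omega)\|<\infty$; $M_A$ is the multiplication operator $(M_Au)(\omega)=A(\omega)u(\omega)$ on $\mathscr H$. A $C^1$ map $F:O\to\mathscr H$ is a regular $S$-memory field if, for every $u\in O$, $DF(u)=\sum_{k\in S}M_{A_k[u]}U^k$ with $A_k[u]\in\mathcal M_s^\infty(\Omega;\mathcal L(H))$; one sets $A_k[u]=0$ for $k\notin S$. $F$ is potential if there exists $E\in C^2(O;\mathbb R)$ with $F=\nabla E$ on $O$; such an $E$ is called a potential of $F$. *)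

theory Defs
  imports "HOL-Probability.Probability" "HOL-Library.Function_Algebras"
begin

text \<open>
  The measure is a variable, so \<open>L\<^sup>2(\<Omega>;H)\<close> cannot be a type. It is treated as the set of
  square-integrable functions \<open>'w \<Rightarrow> 'h\<close> with its \<open>L\<^sup>2\<close> seminorm; elements at distance zero
  (that is, equal almost everywhere) represent the same vector. The differential calculus is
  therefore set up for seminormed spaces, given by a carrier and a seminorm. Pointwise vector space
  structure on functions lets carriers be subsets of a type of class \<^class>\<open>real_vector\<close>.
\<close>

instantiation "fun" :: (type, real_vector) real_vector
begin

definition scaleR_fun :: "real \<Rightarrow> ('a \<Rightarrow> 'b) \<Rightarrow> 'a \<Rightarrow> 'b" where
  "scaleR_fun c f = (\<lambda>x. c *\<^sub>R f x)"

instance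
  by standard (simp_all add: scaleR_fun_def fun_eq_iff scaleR_add_right scaleR_add_left)

end


subsection \<open>Calculus on seminormed spaces\<close>

definition seminorm_open :: "'a::real_vector set \<Rightarrow> ('a \<Rightarrow> real) \<Rightarrow> 'a set \<Rightarrow> bool" where
  "seminorm_open X p V \<longleftrightarrow>
     V \<subseteq> X \<and> (\<forall>u\<in>V. \<exists>e>0. \<forall>v\<in>X. p (v - u) < e \<longrightarrow> v \<in> V)"

text \<open>
  Linearity is required up to \<open>q\<close>-distance zero only. The bound makes \<open>D\<close> map vectors at
  \<open>p\<close>-distance zero to vectors at \<open>q\<close>-distance zero, so \<open>D\<close> descends to the quotients.
\<close>

definition bounded_op ::
  "'a::real_vector set \<Rightarrow> ('a \<Rightarrow> real) \<Rightarrow> 'b::real_vector set \<Rightarrow> ('b \<Rightarrow> real) \<Rightarrow> ('a \<Rightarrow> 'b) \<Rightarrow> bool"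
where
  "bounded_op X p Y q D \<longleftrightarrow>
     D \<in> X \<rightarrow> Y \<and>
     (\<forall>v\<in>X. \<forall>w\<in>X. \<forall>a b. q (D (a *\<^sub>R v + b *\<^sub>R w) - (a *\<^sub>R D v + b *\<^sub>R D w)) = 0) \<and>
     (\<exists>K. \<forall>v\<in>X. q (D v) \<le> K * p v)"

definition op_seminorm ::
  "'a set \<Rightarrow> ('a \<Rightarrow> real) \<Rightarrow> ('b \<Rightarrow> real) \<Rightarrow> ('a \<Rightarrow> 'b) \<Rightarrow> real" where
  "op_seminorm X p q D = (SUP v\<in>{v \<in> X. p v \<le> 1}. q (D v))"

definition dual_carrier :: "'a::real_vector set \<Rightarrow> ('a \<Rightarrow> real) \<Rightarrow> ('a \<Rightarrow> real) set" where
  "dual_carrier X p = {\<phi>. bounded_op X p UNIV abs \<phi>}"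

definition has_frechet_derivative ::
  "'a::real_vector set \<Rightarrow> ('a \<Rightarrow> real) \<Rightarrow> 'b::real_vector set \<Rightarrow> ('b \<Rightarrow> real) \<Rightarrow> 'a set \<Rightarrow>
   ('a \<Rightarrow> 'b) \<Rightarrow> ('a \<Rightarrow> 'b) \<Rightarrow> 'a \<Rightarrow> bool"
where
  "has_frechet_derivative X p Y q V F D u \<longleftrightarrow>
     bounded_op X p Y q D \<and>
     (\<forall>e>0. \<exists>d>0. \<forall>v\<in>V. p (v - u) < d \<longrightarrow> q (F v - F u - D (v - u)) \<le> e * p (v - u))"

text \<open>
  \<open>F\<close> is \<open>C\<^sup>1\<close> on the open set \<open>V\<close> with derivative \<open>DF\<close>. Taking \<open>p (v - u) = 0\<close> in the
  derivative shows that such an \<open>F\<close> is well defined on equivalence classes.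
\<close>

definition C1_with_derivative ::
  "'a::real_vector set \<Rightarrow> ('a \<Rightarrow> real) \<Rightarrow> 'b::real_vector set \<Rightarrow> ('b \<Rightarrow> real) \<Rightarrow> 'a set \<Rightarrow>
   ('a \<Rightarrow> 'b) \<Rightarrow> ('a \<Rightarrow> 'a \<Rightarrow> 'b) \<Rightarrow> bool"
where
  "C1_with_derivative X p Y q V F DF \<longleftrightarrow>
     F \<in> V \<rightarrow> Y \<and>
     (\<forall>u\<in>V. has_frechet_derivative X p Y q V F (DF u) u) \<and>
     (\<forall>u\<in>V. \<forall>e>0. \<exists>d>0. \<forall>v\<in>V. p (v - u) < d \<longrightarrow> op_seminorm X p q (DF v - DF u) < e)"

definition C2_functional ::
  "'a::real_vector set \<Rightarrow> ('a \<Rightarrow> real) \<Rightarrow> 'a set \<Rightarrow> ('a \<Rightarrow> real) \<Rightarrow> bool" where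
  "C2_functional X p V E \<longleftrightarrow>
     (\<exists>DE. C1_with_derivative X p UNIV abs V E DE \<and>
       (\<exists>D2E. C1_with_derivative X p (dual_carrier X p) (op_seminorm X p abs) V DE D2E))"


subsection \<open>Probability spaces and automorphisms\<close>

definition standard_borel :: "'w measure \<Rightarrow> bool" where
  "standard_borel M \<longleftrightarrow>
     (\<exists>X. topspace X = space M \<and> completely_metrizable_space X \<and> second_countable X \<and>
          sets M = sigma_sets (space M) {U. openin X U})"

text \<open>Both usual conventions are admitted: the Borel \<open>\<sigma>\<close>-algebra and its completion.\<close>

definition standard_prob_space :: "'w measure \<Rightarrow> bool" where
  "standard_prob_space M \<longleftrightarrow>
     prob_space M \<and> (\<exists>N. standard_borel N \<and> (M = N \<or> M = completion N))"

definition mp_automorphism :: "'w measure \<Rightarrow> ('w \<Rightarrow> 'w) \<Rightarrow> bool" where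
  "mp_automorphism M \<theta> \<longleftrightarrow>
     bij_betw \<theta> (space M) (space M) \<and>
     \<theta> \<in> M \<rightarrow>\<^sub>M M \<and> inv_into (space M) \<theta> \<in> M \<rightarrow>\<^sub>M M \<and>
     distr M M \<theta> = M"

definition iter :: "'w measure \<Rightarrow> ('w \<Rightarrow> 'w) \<Rightarrow> int \<Rightarrow> 'w \<Rightarrow> 'w" where
  "iter M \<theta> k =
     (if k \<ge> 0 then \<theta> ^^ nat k else inv_into (space M) \<theta> ^^ nat (- k))"


subsection \<open>The space of square-integrable functions and its operators\<close>

definition L2 :: "'w measure \<Rightarrow> ('w \<Rightarrow> 'h::{real_inner, second_countable_topology}) set" where
  "L2 M = {u \<in> borel_measurable M. integrable M (\<lambda>\<omega>. (norm (u \<omega>))\<^sup>2)}"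

definition L2_inner :: "'w measure \<Rightarrow> ('w \<Rightarrow> 'h::real_inner) \<Rightarrow> ('w \<Rightarrow> 'h) \<Rightarrow> real" where
  "L2_inner M u v = (\<integral>\<omega>. u \<omega> \<bullet> v \<omega> \<partial>M)"

definition L2_norm :: "'w measure \<Rightarrow> ('w \<Rightarrow> 'h::real_inner) \<Rightarrow> real" where
  "L2_norm M u = sqrt (L2_inner M u u)"

definition L2_self_adjoint ::
  "'w measure \<Rightarrow> (('w \<Rightarrow> 'h::{real_inner, second_countable_topology}) \<Rightarrow> ('w \<Rightarrow> 'h)) \<Rightarrow> bool"
where
  "L2_self_adjoint M D \<longleftrightarrow>
     bounded_op (L2 M) (L2_norm M) (L2 M) (L2_norm M) D \<and>
     (\<forall>v\<in>L2 M. \<forall>w\<in>L2 M. L2_inner M (D v) w = L2_inner M v (D w))"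

definition koopman :: "'w measure \<Rightarrow> ('w \<Rightarrow> 'w) \<Rightarrow> int \<Rightarrow> ('w \<Rightarrow> 'h) \<Rightarrow> ('w \<Rightarrow> 'h)" where
  "koopman M \<theta> k u = (\<lambda>\<omega>. u (iter M \<theta> k \<omega>))"

definition mult_op ::
  "('w \<Rightarrow> ('h::real_normed_vector \<Rightarrow>\<^sub>L 'h)) \<Rightarrow> ('w \<Rightarrow> 'h) \<Rightarrow> ('w \<Rightarrow> 'h)" where
  "mult_op A u = (\<lambda>\<omega>. blinfun_apply (A \<omega>) (u \<omega>))"

text \<open>
  Since \<open>H\<close> is separable, strong measurability of \<open>\<omega> \<mapsto> A(\<omega>)v\<close> is Borel measurability. The
  second condition says that the essential supremum of the operator norms is finite.
\<close>

definition strong_Linf ::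
  "'w measure \<Rightarrow> ('w \<Rightarrow> ('h::{real_normed_vector, second_countable_topology} \<Rightarrow>\<^sub>L 'h)) set" where
  "strong_Linf M =
     {A. (\<forall>v. (\<lambda>\<omega>. blinfun_apply (A \<omega>) v) \<in> borel_measurable M) \<and>
         (\<exists>C. AE \<omega> in M. norm (A \<omega>) \<le> C)}"


subsection \<open>Memory fields and potentials\<close>

definition regular_memory_field ::
  "'w measure \<Rightarrow> ('w \<Rightarrow> 'w) \<Rightarrow> int set \<Rightarrow> ('w \<Rightarrow> 'h::{real_inner, second_countable_topology}) set \<Rightarrow>
   (('w \<Rightarrow> 'h) \<Rightarrow> ('w \<Rightarrow> 'h)) \<Rightarrow> (('w \<Rightarrow> 'h) \<Rightarrow> ('w \<Rightarrow> 'h) \<Rightarrow> ('w \<Rightarrow> 'h)) \<Rightarrow>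
   (int \<Rightarrow> ('w \<Rightarrow> 'h) \<Rightarrow> 'w \<Rightarrow> ('h \<Rightarrow>\<^sub>L 'h)) \<Rightarrow> bool"
where
  "regular_memory_field M \<theta> S V F DF A \<longleftrightarrow>
     C1_with_derivative (L2 M) (L2_norm M) (L2 M) (L2_norm M) V F DF \<and>
     (\<forall>u\<in>V. (\<forall>k\<in>S. A k u \<in> strong_Linf M) \<and>
             (\<forall>k. k \<notin> S \<longrightarrow> A k u = (\<lambda>\<omega>. 0)) \<and>
             (\<forall>v\<in>L2 M. AE \<omega> in M.
                DF u v \<omega> = (\<Sum>k\<in>S. mult_op (A k u) (koopman M \<theta> k v) \<omega>)))"

definition is_potential ::
  "'w measure \<Rightarrow> ('w \<Rightarrow> 'h::{real_inner, second_countable_topology}) set \<Rightarrow>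
   (('w \<Rightarrow> 'h) \<Rightarrow> ('w \<Rightarrow> 'h)) \<Rightarrow> (('w \<Rightarrow> 'h) \<Rightarrow> real) \<Rightarrow> bool"
where
  "is_potential M V F E \<longleftrightarrow>
     C2_functional (L2 M) (L2_norm M) V E \<and>
     (\<forall>u\<in>V. has_frechet_derivative (L2 M) (L2_norm M) UNIV abs V E (\<lambda>h. L2_inner M (F u) h) u)"

end

theory Submission
  imports Defs
begin

text \<open>
  The theorem combines a Poincare lemma with a uniqueness statement for the coefficients of
  operators of the form \<open>\<Sum>\<^sub>k M\<^bsub>A\<^sub>k\<^esub> U\<^sup>k\<close>.

  A \<open>C\<^sup>1\<close> field on a convex open set is a gradient if and only if its derivative is symmetric. If
  \<open>F\<close> is the gradient of \<open>E\<close>, the second difference of \<open>E\<close> in the directions \<open>v\<close> and \<open>w\<close> is, to second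
  order, both \<open>s\<^sup>2 \<langle>DF(u) w, v\<rangle>\<close> and \<open>s\<^sup>2 \<langle>DF(u) v, w\<rangle>\<close> (\<open>gradient_symmetric\<close>). Conversely, when the
  line integral of \<open>F\<close> along the segment from \<open>u0\<close> to \<open>u\<close> is differentiated in \<open>u\<close> under the integral
  sign, symmetry turns the integrand into a total derivative, and what remains is \<open>F(u)\<close>
  (\<open>radial_potential_has_gradient\<close>). That such a potential is \<open>C\<^sup>2\<close> is immediate from \<open>F\<close> being \<open>C\<^sup>1\<close>
  (\<open>gradient_C2\<close>). All this works for any positive semidefinite form on a vector space, and
  square-integrable functions with the \<open>L\<^sup>2\<close> product are an instance.

  For the description by coefficients, measure invariance gives \<open>(M\<^sub>A U\<^sup>k)\<^sup>* = M\<^sub>B U\<^bsup>-k\<^esup>\<close> with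
  \<open>B(\<omega>) = A(\<theta>\<^bsup>-k\<^esup> \<omega>)\<^sup>*\<close>. Hence \<open>D = \<Sum>\<^sub>k M\<^bsub>A\<^sub>k\<^esub> U\<^sup>k\<close> is self-adjoint exactly if the operator with
  coefficients \<open>A\<^sub>k(\<omega>) - A\<^bsub>-k\<^esub>(\<theta>\<^sup>k \<omega>)\<^sup>*\<close> is zero (\<open>self_adjointness_defect\<close>). As the points
  \<open>\<theta>\<^sup>k \<omega>\<close> are distinct for almost every \<open>\<omega>\<close>, functions supported in sets that contain one of these
  points and none of the others separate the terms, so that every coefficient is zero almost
  everywhere (\<open>weighted_iterates_independent\<close>, \<open>self_adjoint_iff_coefficients\<close>). Adjoints exist in the
  value space by the Riesz representation theorem.
\<close>

section \<open>Semi-inner product spaces\<close>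

text \<open>
  The potential theory below uses only bilinearity, symmetry and positivity of the \<open>L\<^sup>2\<close> product,
  so it is carried out for a subspace with a positive semidefinite form. Vectors of seminorm zero
  need not vanish; since equality up to such vectors is all that an operator has to respect,
  arguments pass to the real numbers \<open>ip x w\<close>, which do not see them.
\<close>

locale semi_inner =
  fixes X :: "'a::real_vector set"
    and ip :: "'a \<Rightarrow> 'a \<Rightarrow> real"
    and p :: "'a \<Rightarrow> real"
  assumes subspace: "subspace X"
    and sym: "u \<in> X \<Longrightarrow> v \<in> X \<Longrightarrow> ip u v = ip v u"
    and add_left: "u \<in> X \<Longrightarrow> v \<in> X \<Longrightarrow> w \<in> X \<Longrightarrow> ip (u + v) w = ip u w + ip v w"
    and scale_left: "u \<in> X \<Longrightarrow> w \<in> X \<Longrightarrow> ip (c *\<^sub>R u) w = c * ip u w"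
    and nonneg: "u \<in> X \<Longrightarrow> 0 \<le> ip u u"
    and seminorm_eq: "p u = sqrt (ip u u)"
begin

lemma carrier [simp, intro]:
  shows "0 \<in> X"
    and "u \<in> X \<Longrightarrow> v \<in> X \<Longrightarrow> u + v \<in> X"
    and "u \<in> X \<Longrightarrow> v \<in> X \<Longrightarrow> u - v \<in> X"
    and "u \<in> X \<Longrightarrow> c *\<^sub>R u \<in> X"
  using subspace by (auto simp: subspace_0 subspace_add subspace_diff subspace_scale)

lemma diff_left: "u \<in> X \<Longrightarrow> v \<in> X \<Longrightarrow> w \<in> X \<Longrightarrow> ip (u - v) w = ip u w - ip v w"
  using add_left[of "u - v" v w] by simp

lemma zero_left [simp]: "w \<in> X \<Longrightarrow> ip 0 w = 0"
  using scale_left[of 0 w 0] by simp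

lemma add_right: "u \<in> X \<Longrightarrow> v \<in> X \<Longrightarrow> w \<in> X \<Longrightarrow> ip w (u + v) = ip w u + ip w v"
  by (simp add: sym[of w] add_left)

lemma scale_right: "u \<in> X \<Longrightarrow> w \<in> X \<Longrightarrow> ip w (c *\<^sub>R u) = c * ip w u"
  by (simp add: sym[of w] scale_left)

lemma diff_right: "u \<in> X \<Longrightarrow> v \<in> X \<Longrightarrow> w \<in> X \<Longrightarrow> ip w (u - v) = ip w u - ip w v"
  by (simp add: sym[of w] diff_left)

lemmas bilinear = add_left diff_left scale_left add_right diff_right scale_right

lemma seminorm_nonneg [simp]: "u \<in> X \<Longrightarrow> 0 \<le> p u"
  by (simp add: seminorm_eq nonneg)

lemma seminorm_power2: "u \<in> X \<Longrightarrow> (p u)\<^sup>2 = ip u u"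
  by (simp add: seminorm_eq nonneg)

lemma seminorm_zero [simp]: "p 0 = 0"
  by (simp add: seminorm_eq)

lemma seminorm_scale: "u \<in> X \<Longrightarrow> p (c *\<^sub>R u) = \<bar>c\<bar> * p u"
  by (simp add: seminorm_eq scale_left scale_right real_sqrt_mult flip: mult.assoc power2_eq_square)

text \<open>
  The quadratic polynomial \<open>t \<mapsto> ip (u + t v) (u + t v)\<close> is nonnegative. If \<open>v\<close> is null it is affine
  and must be constant; otherwise its minimum gives the inequality.
\<close>

lemma Cauchy_Schwarz:
  assumes "u \<in> X" "v \<in> X"
  shows "\<bar>ip u v\<bar> \<le> p u * p v"
proof -
  have poly: "0 \<le> ip u u + 2 * t * ip u v + t\<^sup>2 * ip v v" for t
    using nonneg[of "u + t *\<^sub>R v"] assms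
    by (simp add: bilinear sym[of v u] power2_eq_square algebra_simps)
  have "(ip u v)\<^sup>2 \<le> ip u u * ip v v"
  proof (cases "ip v v = 0")
    case True
    have "ip u v = 0"
    proof (rule ccontr)
      assume "ip u v \<noteq> 0"
      then show False
        using poly[of "- (ip u u + 1) / (2 * ip u v)"] nonneg[OF assms(1)] True by (simp add: field_simps)
    qed
    then show ?thesis using True by simp
  next
    case False
    then have "0 < ip v v" using nonneg[OF assms(2)] by simp
    then show ?thesis
      using poly[of "- ip u v / ip v v"] by (simp add: field_simps power2_eq_square)
  qed
  then have "sqrt ((ip u v)\<^sup>2) \<le> sqrt (ip u u * ip v v)"
    by (rule real_sqrt_le_mono)
  then show ?thesis by (simp add: seminorm_eq real_sqrt_mult)
qed

lemma seminorm_triangle: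
  assumes "u \<in> X" "v \<in> X"
  shows "p (u + v) \<le> p u + p v"
proof (rule power2_le_imp_le)
  show "(p (u + v))\<^sup>2 \<le> (p u + p v)\<^sup>2"
    using assms Cauchy_Schwarz[of u v]
    by (simp add: seminorm_power2 power2_sum bilinear sym[of v u])
qed (use assms in auto)

lemma seminorm_triangle_diff: "u \<in> X \<Longrightarrow> v \<in> X \<Longrightarrow> p (u - v) \<le> p u + p v"
  using seminorm_triangle[of u "(-1) *\<^sub>R v"] carrier(4)[of v "-1"] seminorm_scale[of v "-1"] by simp

lemma seminorm_triangle_minus: "u \<in> X \<Longrightarrow> v \<in> X \<Longrightarrow> p u \<le> p (u - v) + p v"
  using seminorm_triangle[of "u - v" v] by simp

lemma ip_null_left:
  assumes "u \<in> X" "v \<in> X" "p u = 0"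
  shows "ip u v = 0"
  using Cauchy_Schwarz[OF assms(1,2)] assms(3) by simp


subsection \<open>Bounded operators and functionals\<close>

lemma bounded_op_carrier: "bounded_op X p X p D \<Longrightarrow> v \<in> X \<Longrightarrow> D v \<in> X"
  by (auto simp: bounded_op_def)

text \<open>
  Linearity holds only modulo null vectors, and tests against \<open>z\<close> annihilate these.
\<close>

lemma bounded_op_linear:
  assumes D: "bounded_op X p X p D" and "v \<in> X" "w \<in> X" "z \<in> X"
  shows "ip (D (a *\<^sub>R v + b *\<^sub>R w)) z = a * ip (D v) z + b * ip (D w) z"
proof -
  have [simp]: "D v \<in> X" "D w \<in> X" "D (a *\<^sub>R v + b *\<^sub>R w) \<in> X"
    using assms by (auto intro: bounded_op_carrier)
  have "p (D (a *\<^sub>R v + b *\<^sub>R w) - (a *\<^sub>R D v + b *\<^sub>R D w)) = 0"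
    using D assms by (auto simp: bounded_op_def)
  then have "ip (D (a *\<^sub>R v + b *\<^sub>R w) - (a *\<^sub>R D v + b *\<^sub>R D w)) z = 0"
    using assms by (intro ip_null_left) auto
  then show ?thesis using assms by (simp add: bilinear)
qed

lemma bounded_op_scale:
  "bounded_op X p X p D \<Longrightarrow> v \<in> X \<Longrightarrow> z \<in> X \<Longrightarrow> ip (D (a *\<^sub>R v)) z = a * ip (D v) z"
  using bounded_op_linear[of D v v z a 0] by simp

lemma bounded_op_seminorm_scale:
  assumes D: "bounded_op X p X p D" and "v \<in> X"
  shows "p (D (a *\<^sub>R v)) \<le> \<bar>a\<bar> * p (D v)"
proof -
  have [simp]: "D v \<in> X" "D (a *\<^sub>R v) \<in> X"
    using assms by (auto intro: bounded_op_carrier)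
  have "p (D (a *\<^sub>R v + 0 *\<^sub>R v) - (a *\<^sub>R D v + 0 *\<^sub>R D v)) = 0"
    using D assms unfolding bounded_op_def by blast
  then show ?thesis
    using seminorm_triangle_minus[of "D (a *\<^sub>R v)" "a *\<^sub>R D v"] by (simp add: seminorm_scale)
qed

lemma bounded_op_bound:
  assumes "bounded_op X p X p D"
  obtains K where "0 \<le> K" "\<And>v. v \<in> X \<Longrightarrow> p (D v) \<le> K * p v"
proof -
  obtain K where K: "\<And>v. v \<in> X \<Longrightarrow> p (D v) \<le> K * p v"
    using assms unfolding bounded_op_def by blast
  have "p (D v) \<le> \<bar>K\<bar> * p v" if "v \<in> X" for v
    using K[OF that] mult_right_mono[OF abs_ge_self seminorm_nonneg[OF that], of K] by linarith
  then show ?thesis using that[of "\<bar>K\<bar>"] by auto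
qed

lemma bounded_op_diff:
  assumes D: "bounded_op X p X p D" and D': "bounded_op X p X p D'"
  shows "bounded_op X p X p (D - D')"
proof -
  note [simp] = bounded_op_carrier[OF D] bounded_op_carrier[OF D']
  have lin: "p ((D - D') (a *\<^sub>R v + b *\<^sub>R w) - (a *\<^sub>R (D - D') v + b *\<^sub>R (D - D') w)) = 0"
    if vw: "v \<in> X" "w \<in> X" for v w a b
  proof -
    let ?d = "D (a *\<^sub>R v + b *\<^sub>R w) - (a *\<^sub>R D v + b *\<^sub>R D w)"
    let ?d' = "D' (a *\<^sub>R v + b *\<^sub>R w) - (a *\<^sub>R D' v + b *\<^sub>R D' w)"
    have "p ?d = 0" "p ?d' = 0"
      using D D' vw by (auto simp: bounded_op_def)
    then have "p (?d - ?d') \<le> 0"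
      using seminorm_triangle_diff[of ?d ?d'] vw by simp
    then have "p (?d - ?d') = 0"
      using vw by (intro antisym) auto
    moreover have "?d - ?d' = (D - D') (a *\<^sub>R v + b *\<^sub>R w) - (a *\<^sub>R (D - D') v + b *\<^sub>R (D - D') w)"
      by (simp add: algebra_simps)
    ultimately show ?thesis by simp
  qed
  obtain K where K: "\<And>v. v \<in> X \<Longrightarrow> p (D v) \<le> K * p v" using bounded_op_bound[OF D] by metis
  obtain K' where K': "\<And>v. v \<in> X \<Longrightarrow> p (D' v) \<le> K' * p v" using bounded_op_bound[OF D'] by metis
  have "p ((D - D') v) \<le> (K + K') * p v" if "v \<in> X" for v
    using seminorm_triangle_diff[of "D v" "D' v"] K[OF that] K'[OF that] that
    by (simp add: distrib_right)
  then show ?thesis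
    using lin unfolding bounded_op_def by auto
qed

text \<open>
  The operator seminorm is a supremum of real numbers, hence meaningful only for sets bounded above;
  boundedness of \<open>D\<close> supplies that.
\<close>

lemma op_seminorm_upper:
  assumes D: "bounded_op X p X p D" and w: "w \<in> X" "p w \<le> 1"
  shows "p (D w) \<le> op_seminorm X p p D"
proof -
  obtain K where K: "0 \<le> K" "\<And>v. v \<in> X \<Longrightarrow> p (D v) \<le> K * p v"
    using bounded_op_bound[OF D] by metis
  have "bdd_above ((\<lambda>v. p (D v)) ` {v \<in> X. p v \<le> 1})"
  proof (rule bdd_aboveI2)
    fix v assume "v \<in> {v \<in> X. p v \<le> 1}"
    then show "p (D v) \<le> K" using K(2)[of v] mult_left_mono[of "p v" 1 K] K(1) by auto
  qed
  then show ?thesis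
    unfolding op_seminorm_def using w by (intro cSUP_upper) auto
qed

text \<open>
  Rescaling to the unit sphere is possible only for vectors of positive seminorm; the others are
  mapped to null vectors because \<open>D\<close> is bounded.
\<close>

lemma bounded_op_op_seminorm:
  assumes D: "bounded_op X p X p D" and v: "v \<in> X"
  shows "p (D v) \<le> op_seminorm X p p D * p v"
proof (cases "p v = 0")
  case True
  obtain K where "p (D v) \<le> K * p v"
    using bounded_op_bound[OF D] v by metis
  then show ?thesis using True by simp
next
  case False
  define w where "w = (1 / p v) *\<^sub>R v"
  have w: "w \<in> X" "p w \<le> 1" and vw: "v = p v *\<^sub>R w"
    using v False by (auto simp: w_def seminorm_scale)
  have "p (D v) \<le> p v * p (D w)"
    using bounded_op_seminorm_scale[OF D w(1), of "p v"] v by (simp flip: vw)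
  then show ?thesis
    using v mult_left_mono[OF op_seminorm_upper[OF D w], of "p v"] by (simp add: mult.commute)
qed

lemma op_seminorm_le:
  assumes "\<And>v. v \<in> X \<Longrightarrow> p v \<le> 1 \<Longrightarrow> q (D v) \<le> K"
  shows "op_seminorm X p q D \<le> K"
  unfolding op_seminorm_def
proof (rule cSUP_least)
  show "{v \<in> X. p v \<le> 1} \<noteq> {}" by (auto intro!: exI[of _ 0])
qed (use assms in auto)

text \<open>
  Cauchy--Schwarz transfers estimates in the space to estimates of the functionals \<open>ip z\<close> in the
  dual. Only the values of \<open>\<phi>\<close> on the carrier matter, so \<open>\<phi>\<close> may be a combination of several
  functionals \<open>ip z'\<close>, which need not agree with \<open>ip z\<close> outside the carrier.
\<close>

lemma functional_op_seminorm:
  assumes z: "z \<in> X" and eq: "\<And>h. h \<in> X \<Longrightarrow> \<phi> h = ip z h"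
  shows "op_seminorm X p abs \<phi> \<le> p z" "0 \<le> op_seminorm X p abs \<phi>"
proof -
  have le: "\<bar>\<phi> h\<bar> \<le> p z" if "h \<in> X" "p h \<le> 1" for h
    using Cauchy_Schwarz[OF z that(1)] mult_left_mono[OF that(2) seminorm_nonneg[OF z]] that eq
    by simp
  then show "op_seminorm X p abs \<phi> \<le> p z"
    by (intro op_seminorm_le) auto
  have "bdd_above ((\<lambda>v. \<bar>\<phi> v\<bar>) ` {v \<in> X. p v \<le> 1})"
    using le by (auto intro!: bdd_aboveI2[where M = "p z"])
  then have "\<bar>\<phi> 0\<bar> \<le> op_seminorm X p abs \<phi>"
    unfolding op_seminorm_def by (intro cSUP_upper) auto
  then show "0 \<le> op_seminorm X p abs \<phi>" by linarith
qed

lemma bounded_op_ip: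
  assumes "z \<in> X"
  shows "bounded_op X p UNIV abs (ip z)"
  unfolding bounded_op_def
  using assms Cauchy_Schwarz[OF assms] by (auto simp: bilinear)

end


section \<open>Gradient fields\<close>

locale C1_field = semi_inner X ip p
  for X :: "'a::real_vector set" and ip :: "'a \<Rightarrow> 'a \<Rightarrow> real" and p :: "'a \<Rightarrow> real" +
  fixes V :: "'a set" and F :: "'a \<Rightarrow> 'a" and DF :: "'a \<Rightarrow> 'a \<Rightarrow> 'a"
  assumes open_domain: "seminorm_open X p V"
    and C1: "C1_with_derivative X p X p V F DF"
begin

definition has_gradient :: "('a \<Rightarrow> real) \<Rightarrow> bool" where
  "has_gradient E \<longleftrightarrow> (\<forall>u\<in>V. has_frechet_derivative X p UNIV abs V E (ip (F u)) u)"

definition symmetric_derivative :: bool where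
  "symmetric_derivative \<longleftrightarrow> (\<forall>u\<in>V. \<forall>v\<in>X. \<forall>w\<in>X. ip (DF u v) w = ip v (DF u w))"

lemma domain_carrier [simp, dest]: "u \<in> V \<Longrightarrow> u \<in> X"
  using open_domain by (auto simp: seminorm_open_def)

lemma field_carrier [simp]: "u \<in> V \<Longrightarrow> F u \<in> X"
  using C1 by (auto simp: C1_with_derivative_def)

lemma derivative_bounded_op: "u \<in> V \<Longrightarrow> bounded_op X p X p (DF u)"
  using C1 by (auto simp: C1_with_derivative_def has_frechet_derivative_def)

lemma derivative_carrier [simp]: "u \<in> V \<Longrightarrow> v \<in> X \<Longrightarrow> DF u v \<in> X"
  by (blast intro: bounded_op_carrier derivative_bounded_op)

lemma frechet:
  assumes "u \<in> V" "0 < e"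
  obtains d where "0 < d"
    "\<And>v. v \<in> V \<Longrightarrow> p (v - u) < d \<Longrightarrow> p (F v - F u - DF u (v - u)) \<le> e * p (v - u)"
proof -
  have "has_frechet_derivative X p X p V F (DF u) u"
    using C1 assms(1) unfolding C1_with_derivative_def by blast
  then show ?thesis
    using that assms(2) unfolding has_frechet_derivative_def by metis
qed

lemma domain_ball:
  assumes "u \<in> V"
  obtains d where "0 < d" "\<And>v. v \<in> X \<Longrightarrow> p (v - u) < d \<Longrightarrow> v \<in> V"
  using open_domain assms unfolding seminorm_open_def by metis

lemma seminorm_tendsto_eventually:
  assumes "((\<lambda>z. p (\<Gamma> z - u)) \<longlongrightarrow> 0) Fl" "0 < d"
  shows "\<forall>\<^sub>F z in Fl. p (\<Gamma> z - u) < d"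
  using assms by (auto dest: order_tendstoD)

text \<open>
  Near \<open>u\<close> the field is Lipschitz at \<open>u\<close>: the remainder is at most \<open>p (v - u)\<close>, and the derivative
  is bounded.
\<close>

lemma field_continuous:
  assumes u: "u \<in> V" and e: "0 < e"
  obtains d where "0 < d" "\<And>v. v \<in> V \<Longrightarrow> p (v - u) < d \<Longrightarrow> p (F v - F u) < e"
proof -
  obtain d where d: "0 < d"
    "\<And>v. v \<in> V \<Longrightarrow> p (v - u) < d \<Longrightarrow> p (F v - F u - DF u (v - u)) \<le> 1 * p (v - u)"
    using frechet[OF u, of 1] by auto
  obtain K where K: "0 \<le> K" "\<And>v. v \<in> X \<Longrightarrow> p (DF u v) \<le> K * p v"
    using bounded_op_bound[OF derivative_bounded_op[OF u]] by metis
  show ?thesis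
  proof (rule that[of "min d (e / (1 + K))"])
    show "0 < min d (e / (1 + K))" using d e K by simp
    fix v assume v: "v \<in> V" "p (v - u) < min d (e / (1 + K))"
    have "p (F v - F u) \<le> (1 + K) * p (v - u)"
      using seminorm_triangle_minus[of "F v - F u" "DF u (v - u)"] d(2)[of v] K(2)[of "v - u"] u v
      by (simp add: distrib_right)
    also have "\<dots> < e" using v K by (simp add: field_simps)
    finally show "p (F v - F u) < e" .
  qed
qed

lemma ip_field_tendsto:
  assumes u: "u \<in> V" and ev: "\<forall>\<^sub>F z in Fl. \<Gamma> z \<in> V" and lim: "((\<lambda>z. p (\<Gamma> z - u)) \<longlongrightarrow> 0) Fl"
    and w: "w \<in> X"
  shows "((\<lambda>z. ip (F (\<Gamma> z)) w) \<longlongrightarrow> ip (F u) w) Fl"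
proof (rule tendstoI)
  fix e :: real assume e: "0 < e"
  have pw: "0 < p w + 1" using w by (simp add: add_nonneg_pos)
  obtain d where d: "0 < d"
    "\<And>v. v \<in> V \<Longrightarrow> p (v - u) < d \<Longrightarrow> p (F v - F u) < e / (p w + 1)"
    using field_continuous[OF u, of "e / (p w + 1)"] e pw by auto
  have close: "dist (ip (F v) w) (ip (F u) w) < e" if v: "v \<in> V" "p (v - u) < d" for v
  proof -
    have "\<bar>ip (F v) w - ip (F u) w\<bar> = \<bar>ip (F v - F u) w\<bar>"
      using u v w by (simp add: diff_left)
    also have "\<dots> \<le> p (F v - F u) * p w"
      using u v w by (intro Cauchy_Schwarz) auto
    also have "\<dots> \<le> e / (p w + 1) * p w"
      using d(2)[OF v] w by (intro mult_right_mono) auto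
    also have "\<dots> < e" using e pw by (simp add: field_simps)
    finally show ?thesis by (simp add: dist_real_def)
  qed
  show "\<forall>\<^sub>F z in Fl. dist (ip (F (\<Gamma> z)) w) (ip (F u) w) < e"
    using ev seminorm_tendsto_eventually[OF lim d(1)] by eventually_elim (rule close)
qed

text \<open>
  Continuity of the derivative in operator seminorm implies its weak continuity along any filter;
  this weak form is what differentiation under the integral sign needs.
\<close>

lemma ip_derivative_tendsto:
  assumes u: "u \<in> V" and ev: "\<forall>\<^sub>F z in Fl. \<Gamma> z \<in> V" and lim: "((\<lambda>z. p (\<Gamma> z - u)) \<longlongrightarrow> 0) Fl"
    and h: "h \<in> X" and w: "w \<in> X"
  shows "((\<lambda>z. ip (DF (\<Gamma> z) h) w) \<longlongrightarrow> ip (DF u h) w) Fl"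
proof (rule tendstoI)
  fix e :: real assume e: "0 < e"
  let ?c = "p h * p w + 1"
  have c: "0 < ?c" using h w by (simp add: add_nonneg_pos)
  obtain d where d: "0 < d"
    "\<And>v. v \<in> V \<Longrightarrow> p (v - u) < d \<Longrightarrow> op_seminorm X p p (DF v - DF u) < e / ?c"
    using C1 u e c unfolding C1_with_derivative_def by (metis divide_pos_pos)
  have close: "dist (ip (DF v h) w) (ip (DF u h) w) < e" if v: "v \<in> V" "p (v - u) < d" for v
  proof -
    let ?D = "DF v - DF u"
    have D: "bounded_op X p X p ?D"
      using u v by (intro bounded_op_diff derivative_bounded_op)
    have "\<bar>ip (DF v h) w - ip (DF u h) w\<bar> = \<bar>ip (?D h) w\<bar>"
      using u v h w by (simp add: diff_left)
    also have "\<dots> \<le> p (?D h) * p w"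
      by (rule Cauchy_Schwarz[OF bounded_op_carrier[OF D h] w])
    also have "\<dots> \<le> (op_seminorm X p p ?D * p h) * p w"
      using w by (intro mult_right_mono bounded_op_op_seminorm D h) auto
    also have "\<dots> = op_seminorm X p p ?D * (p h * p w)" by simp
    also have "\<dots> \<le> (e / ?c) * (p h * p w)"
      using d(2)[OF v] h w by (intro mult_right_mono) auto
    also have "\<dots> < e" using e c by (simp add: field_simps)
    finally show ?thesis by (simp add: dist_real_def)
  qed
  show "\<forall>\<^sub>F z in Fl. dist (ip (DF (\<Gamma> z) h) w) (ip (DF u h) w) < e"
    using ev seminorm_tendsto_eventually[OF lim d(1)] by eventually_elim (rule close)
qed

text \<open>
  The common part of the two lemmas below: calculus of one real variable applies to
  \<open>v \<mapsto> ip (F v) w\<close> and to potentials through their restrictions to lines.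
\<close>

lemma frechet_along_line:
  fixes g :: "'a \<Rightarrow> real"
  assumes x: "x \<in> X" and h: "h \<in> X" and t: "t \<in> T" and T: "\<And>s. s \<in> T \<Longrightarrow> x + s *\<^sub>R h \<in> V"
    and frechet: "\<And>e. 0 < e \<Longrightarrow> \<exists>d>0. \<forall>v\<in>V. p (v - (x + t *\<^sub>R h)) < d \<longrightarrow>
        \<bar>g v - g (x + t *\<^sub>R h) - L (v - (x + t *\<^sub>R h))\<bar> \<le> e * p (v - (x + t *\<^sub>R h))"
    and L: "\<And>c. L (c *\<^sub>R h) = c * L h"
  shows "((\<lambda>s. g (x + s *\<^sub>R h)) has_real_derivative L h) (at t within T)"
  unfolding has_field_derivative_def has_derivative_within_alt
proof (intro conjI allI impI)
  show "bounded_linear ((*) (L h))" by (rule bounded_linear_mult_right)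
  fix e :: real assume e: "0 < e"
  have ph: "0 < p h + 1" using h by (simp add: add_nonneg_pos)
  obtain d where d: "0 < d" "\<And>v. v \<in> V \<Longrightarrow> p (v - (x + t *\<^sub>R h)) < d \<Longrightarrow>
      \<bar>g v - g (x + t *\<^sub>R h) - L (v - (x + t *\<^sub>R h))\<bar> \<le> e / (p h + 1) * p (v - (x + t *\<^sub>R h))"
    using frechet[of "e / (p h + 1)"] e ph by (metis divide_pos_pos)
  show "\<exists>d>0. \<forall>s\<in>T. norm (s - t) < d \<longrightarrow>
      norm (g (x + s *\<^sub>R h) - g (x + t *\<^sub>R h) - L h * (s - t)) \<le> e * norm (s - t)"
  proof (intro exI[of _ "d / (p h + 1)"] conjI ballI impI)
    show "0 < d / (p h + 1)" using d ph by simp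
    fix s assume s: "s \<in> T" "norm (s - t) < d / (p h + 1)"
    have eq: "x + s *\<^sub>R h - (x + t *\<^sub>R h) = (s - t) *\<^sub>R h" by (simp add: algebra_simps)
    have st: "\<bar>s - t\<bar> * (p h + 1) < d" using s ph by (simp add: field_simps)
    have "\<bar>s - t\<bar> * p h \<le> \<bar>s - t\<bar> * (p h + 1)" by (intro mult_left_mono) auto
    then have "p (x + s *\<^sub>R h - (x + t *\<^sub>R h)) < d"
      using st by (simp only: eq seminorm_scale[OF h])
    from d(2)[OF T[OF s(1)] this]
    have "\<bar>g (x + s *\<^sub>R h) - g (x + t *\<^sub>R h) - (s - t) * L h\<bar> \<le> e / (p h + 1) * (\<bar>s - t\<bar> * p h)"
      using h by (simp only: eq L seminorm_scale)
    also have "\<dots> = e * \<bar>s - t\<bar> * (p h / (p h + 1))" by simp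
    also have "\<dots> \<le> e * \<bar>s - t\<bar> * 1" using e ph by (intro mult_left_mono) auto
    finally show "norm (g (x + s *\<^sub>R h) - g (x + t *\<^sub>R h) - L h * (s - t)) \<le> e * norm (s - t)"
      by (simp add: mult.commute)
  qed
qed

lemma field_along_line:
  assumes x: "x \<in> X" and h: "h \<in> X" and w: "w \<in> X" and t: "t \<in> T"
    and T: "\<And>s. s \<in> T \<Longrightarrow> x + s *\<^sub>R h \<in> V"
  shows "((\<lambda>s. ip (F (x + s *\<^sub>R h)) w) has_real_derivative ip (DF (x + t *\<^sub>R h) h) w) (at t within T)"
proof (rule frechet_along_line[OF x h t T, where L = "\<lambda>k. ip (DF (x + t *\<^sub>R h) k) w"])
  let ?u = "x + t *\<^sub>R h"
  have u: "?u \<in> V" by (rule T[OF t])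
  show "ip (DF ?u (c *\<^sub>R h)) w = c * ip (DF ?u h) w" for c
    by (rule bounded_op_scale[OF derivative_bounded_op[OF u] h w])
  fix e :: real assume e: "0 < e"
  have pw: "0 < p w + 1" using w by (simp add: add_nonneg_pos)
  obtain d where d: "0 < d" "\<And>v. v \<in> V \<Longrightarrow> p (v - ?u) < d \<Longrightarrow>
      p (F v - F ?u - DF ?u (v - ?u)) \<le> e / (p w + 1) * p (v - ?u)"
    using frechet[OF u, of "e / (p w + 1)"] e pw by auto
  show "\<exists>d>0. \<forall>v\<in>V. p (v - ?u) < d \<longrightarrow>
      \<bar>ip (F v) w - ip (F ?u) w - ip (DF ?u (v - ?u)) w\<bar> \<le> e * p (v - ?u)"
  proof (intro exI[of _ d] conjI ballI impI d(1))
    fix v assume v: "v \<in> V" "p (v - ?u) < d"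
    have carr: "v - ?u \<in> X" "F v \<in> X" "F ?u \<in> X" "DF ?u (v - ?u) \<in> X"
      using u v by auto
    have "\<bar>ip (F v) w - ip (F ?u) w - ip (DF ?u (v - ?u)) w\<bar> = \<bar>ip (F v - F ?u - DF ?u (v - ?u)) w\<bar>"
      using carr w by (simp add: diff_left)
    also have "\<dots> \<le> p (F v - F ?u - DF ?u (v - ?u)) * p w"
      using carr w by (intro Cauchy_Schwarz) auto
    also have "\<dots> \<le> (e / (p w + 1) * p (v - ?u)) * p w"
      using d(2)[OF v] w by (intro mult_right_mono) auto
    also have "\<dots> = (e * p (v - ?u)) * (p w / (p w + 1))" by simp
    also have "\<dots> \<le> (e * p (v - ?u)) * 1"
      using e pw carr by (intro mult_left_mono) auto
    finally show "\<bar>ip (F v) w - ip (F ?u) w - ip (DF ?u (v - ?u)) w\<bar> \<le> e * p (v - ?u)"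
      by simp
  qed
qed

lemma gradient_along_line:
  assumes E: "has_gradient E" and x: "x \<in> X" and h: "h \<in> X" and t: "t \<in> T"
    and T: "\<And>s. s \<in> T \<Longrightarrow> x + s *\<^sub>R h \<in> V"
  shows "((\<lambda>s. E (x + s *\<^sub>R h)) has_real_derivative ip (F (x + t *\<^sub>R h)) h) (at t within T)"
proof (rule frechet_along_line[OF x h t T, where L = "ip (F (x + t *\<^sub>R h))"])
  have u: "x + t *\<^sub>R h \<in> V" by (rule T[OF t])
  show "ip (F (x + t *\<^sub>R h)) (c *\<^sub>R h) = c * ip (F (x + t *\<^sub>R h)) h" for c
    using u h by (simp add: scale_right)
qed (use E T[OF t] in \<open>auto simp: has_gradient_def has_frechet_derivative_def\<close>)


subsection \<open>The derivative of a gradient is symmetric\<close>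

text \<open>
  With \<open>g \<tau> = E (u + s w + \<tau> v) - E (u + \<tau> v)\<close> the second difference is \<open>g s - g 0\<close>. By the mean
  value theorem it equals \<open>s * ip (F (u + s w + \<xi> v) - F (u + \<xi> v)) v\<close>, and the expansion of \<open>F\<close>
  at \<open>u\<close> turns the difference of the two values of \<open>F\<close> into \<open>s DF(u) w\<close> up to \<open>o(s)\<close>.
\<close>

lemma second_difference:
  assumes E: "has_gradient E" and u: "u \<in> V" and v: "v \<in> X" and w: "w \<in> X" and e: "0 < e"
  shows "\<forall>\<^sub>F s in at_right 0.
    \<bar>E (u + s *\<^sub>R v + s *\<^sub>R w) - E (u + s *\<^sub>R v) - E (u + s *\<^sub>R w) + E u - s\<^sup>2 * ip (DF u w) v\<bar> \<le> e * s\<^sup>2"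
proof -
  define m where "m = p v + p w"
  have m: "0 \<le> m" "p v \<le> m" using v w by (auto simp: m_def)
  \<comment> \<open>The two points at which \<open>F\<close> is expanded lie within \<open>s * m\<close> of \<open>u\<close>; after pairing with \<open>v\<close> their
    errors add up to \<open>2 * e' * m * p v * s\<close>. The summand \<open>1\<close> prevents division by zero.\<close>
  define e' where "e' = e / (2 * m * p v + 1)"
  have c: "0 < 2 * m * p v + 1" using m v by (simp add: add_nonneg_pos)
  have e': "0 < e'" "2 * e' * m * p v \<le> e"
    using e c by (auto simp: e'_def field_simps)
  obtain d where d: "0 < d"
    "\<And>x. x \<in> V \<Longrightarrow> p (x - u) < d \<Longrightarrow> p (F x - F u - DF u (x - u)) \<le> e' * p (x - u)"
    using frechet[OF u e'(1)] by blast
  obtain r where r: "0 < r" "\<And>x. x \<in> X \<Longrightarrow> p (x - u) < r \<Longrightarrow> x \<in> V"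
    using domain_ball[OF u] by blast
  define \<delta> where "\<delta> = min d r / (m + 1)"
  have \<delta>: "0 < \<delta>" using d r m by (simp add: \<delta>_def)
  have bound: "\<bar>E (u + s *\<^sub>R v + s *\<^sub>R w) - E (u + s *\<^sub>R v) - E (u + s *\<^sub>R w) + E u
      - s\<^sup>2 * ip (DF u w) v\<bar> \<le> e * s\<^sup>2" if s: "0 < s" "s < \<delta>" for s
  proof -
    have sm: "s * m < min d r"
    proof -
      have "s * (m + 1) < min d r" using s m by (simp add: \<delta>_def field_simps)
      then show ?thesis using s by (simp add: algebra_simps)
    qed
    let ?k = "\<lambda>\<tau> c. \<tau> *\<^sub>R v + c *\<^sub>R w"
    have k: "p (?k \<tau> c) \<le> s * m" if "0 \<le> \<tau>" "\<tau> \<le> s" "0 \<le> c" "c \<le> s" for \<tau> c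
    proof -
      have "p (?k \<tau> c) \<le> \<tau> * p v + c * p w"
        using seminorm_triangle[of "\<tau> *\<^sub>R v" "c *\<^sub>R w"] v w that by (simp add: seminorm_scale)
      also have "\<dots> \<le> s * p v + s * p w"
        using that v w by (intro add_mono mult_right_mono) auto
      finally show ?thesis by (simp add: m_def distrib_left)
    qed
    have V: "u + ?k \<tau> c \<in> V" if "0 \<le> \<tau>" "\<tau> \<le> s" "0 \<le> c" "c \<le> s" for \<tau> c
      using r(2)[of "u + ?k \<tau> c"] k[OF that] sm u v w by auto
    have approx: "p (F (u + ?k \<tau> c) - F u - DF u (?k \<tau> c)) \<le> e' * (s * m)"
      if "0 \<le> \<tau>" "\<tau> \<le> s" "0 \<le> c" "c \<le> s" for \<tau> c
    proof -
      have "p (F (u + ?k \<tau> c) - F u - DF u (?k \<tau> c)) \<le> e' * p (?k \<tau> c)"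
        using d(2)[OF V[OF that]] k[OF that] sm by simp
      also have "\<dots> \<le> e' * (s * m)" using k[OF that] e'(1) by (intro mult_left_mono) auto
      finally show ?thesis .
    qed
    let ?g = "\<lambda>\<tau>. E ((u + s *\<^sub>R w) + \<tau> *\<^sub>R v) - E (u + \<tau> *\<^sub>R v)"
    let ?g' = "\<lambda>\<tau>. ip (F ((u + s *\<^sub>R w) + \<tau> *\<^sub>R v)) v - ip (F (u + \<tau> *\<^sub>R v)) v"
    have "\<exists>\<xi>\<in>{0..s}. ?g s - ?g 0 = (\<lambda>x. ?g' \<xi> * x) (s - 0)"
    proof (rule mvt_very_simple)
      fix \<tau> assume \<tau>: "0 \<le> \<tau>" "\<tau> \<le> s"
      have "(?g has_real_derivative ?g' \<tau>) (at \<tau> within {0..s})"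
      proof (intro DERIV_diff gradient_along_line[OF E])
        fix \<sigma> assume "\<sigma> \<in> {0..s}"
        then show "u + s *\<^sub>R w + \<sigma> *\<^sub>R v \<in> V" "u + \<sigma> *\<^sub>R v \<in> V"
          using V[of \<sigma> s] V[of \<sigma> 0] s by (auto simp: add_ac)
      qed (use u v w \<tau> in auto)
      then show "(?g has_derivative (\<lambda>x. ?g' \<tau> * x)) (at \<tau> within {0..s})"
        by (simp add: has_field_derivative_def)
    qed (use s in simp)
    then obtain \<xi> where \<xi>: "0 \<le> \<xi>" "\<xi> \<le> s" and g: "?g s - ?g 0 = ?g' \<xi> * s" by auto
    let ?a = "F (u + ?k \<xi> s) - F u - DF u (?k \<xi> s)" and ?b = "F (u + ?k \<xi> 0) - F u - DF u (?k \<xi> 0)"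
    have ab: "?a \<in> X" "?b \<in> X" "p ?a \<le> e' * (s * m)" "p ?b \<le> e' * (s * m)"
      using V[of \<xi> s] V[of \<xi> 0] approx[of \<xi> s] approx[of \<xi> 0] \<xi> s u v w by auto
    have "ip (DF u (?k \<xi> s)) v - ip (DF u (?k \<xi> 0)) v = s * ip (DF u w) v"
      by (simp only: bounded_op_linear[OF derivative_bounded_op[OF u] v w v])
    moreover have "?g' \<xi> = ip (F (u + ?k \<xi> s)) v - ip (F (u + ?k \<xi> 0)) v"
      by (simp add: add_ac)
    moreover have "ip ?a v - ip ?b v =
        ip (F (u + ?k \<xi> s)) v - ip (F (u + ?k \<xi> 0)) v - (ip (DF u (?k \<xi> s)) v - ip (DF u (?k \<xi> 0)) v)"
      using V[of \<xi> s] V[of \<xi> 0] \<xi> s u v w by (simp add: diff_left)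
    ultimately have "?g' \<xi> - s * ip (DF u w) v = ip ?a v - ip ?b v" by linarith
    also have "\<bar>\<dots>\<bar> \<le> p ?a * p v + p ?b * p v"
      using Cauchy_Schwarz[OF ab(1) v] Cauchy_Schwarz[OF ab(2) v] by linarith
    also have "\<dots> \<le> e' * (s * m) * p v + e' * (s * m) * p v"
      using ab v by (intro add_mono mult_right_mono) auto
    also have "\<dots> = s * (2 * e' * m * p v)" by simp
    also have "\<dots> \<le> s * e" using e'(2) s by (intro mult_left_mono) auto
    finally have "s * \<bar>?g' \<xi> - s * ip (DF u w) v\<bar> \<le> s * (s * e)"
      using s by (intro mult_left_mono) auto
    moreover have "s * \<bar>?g' \<xi> - s * ip (DF u w) v\<bar> = \<bar>?g' \<xi> * s - s\<^sup>2 * ip (DF u w) v\<bar>"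
    proof -
      have "?g' \<xi> * s - s\<^sup>2 * ip (DF u w) v = s * (?g' \<xi> - s * ip (DF u w) v)"
        by (simp only: right_diff_distrib power2_eq_square mult_ac)
      then show ?thesis using s by (simp only: abs_mult)
    qed
    moreover have "?g s - ?g 0 = E (u + s *\<^sub>R v + s *\<^sub>R w) - E (u + s *\<^sub>R v) - E (u + s *\<^sub>R w) + E u"
      by (simp add: add_ac)
    ultimately show ?thesis
      using g by (simp add: power2_eq_square mult_ac)
  qed
  show ?thesis
    unfolding eventually_at_right_field using \<delta> bound by auto
qed

text \<open>
  The second difference of \<open>E\<close> does not change when \<open>v\<close> and \<open>w\<close> are exchanged. Dividing the two
  expansions by \<open>s\<^sup>2\<close> and letting \<open>s\<close> tend to zero identifies the two bilinear forms.
\<close>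

theorem gradient_symmetric:
  assumes E: "has_gradient E"
  shows symmetric_derivative
  unfolding symmetric_derivative_def
proof (intro ballI)
  fix u v w assume u: "u \<in> V" and v: "v \<in> X" and w: "w \<in> X"
  have "\<bar>ip (DF u w) v - ip (DF u v) w\<bar> \<le> 0 + e" if e: "0 < e" for e
  proof -
    have "e / 2 > 0" using e by simp
    from second_difference[OF E u v w this] second_difference[OF E u w v this]
    have "\<forall>\<^sub>F s in at_right 0. \<bar>s\<^sup>2 * ip (DF u w) v - s\<^sup>2 * ip (DF u v) w\<bar> \<le> e * s\<^sup>2"
    proof eventually_elim
      case (elim s)
      have "u + s *\<^sub>R w + s *\<^sub>R v = u + s *\<^sub>R v + s *\<^sub>R w" by (simp add: add_ac)
      with elim show ?case by (simp only: abs_le_iff) (simp add: field_simps)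
    qed
    moreover have "\<forall>\<^sub>F s in at_right (0::real). 0 < s"
      by (simp add: eventually_at_right_less)
    ultimately have "\<forall>\<^sub>F s in at_right (0::real). \<bar>ip (DF u w) v - ip (DF u v) w\<bar> \<le> e"
    proof eventually_elim
      case (elim s)
      have "s\<^sup>2 * \<bar>ip (DF u w) v - ip (DF u v) w\<bar> \<le> s\<^sup>2 * e"
        using elim(1) by (simp add: abs_mult mult.commute flip: right_diff_distrib)
      then show ?case using elim(2) by simp
    qed
    then show ?thesis by (simp add: eventually_const_iff)
  qed
  then have "\<bar>ip (DF u w) v - ip (DF u v) w\<bar> \<le> 0" by (rule field_le_epsilon)
  then show "ip (DF u v) w = ip v (DF u w)"
    using u v w by (simp add: sym[of v])
qed


subsection \<open>A field with symmetric derivative is a gradient\<close>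

definition radial_potential :: "'a \<Rightarrow> real \<Rightarrow> 'a \<Rightarrow> real" where
  "radial_potential u0 C u = C + integral {0..1} (\<lambda>t. ip (F (u0 + t *\<^sub>R (u - u0))) (u - u0))"

lemma segment_in_domain:
  assumes "convex V" "u \<in> V" "v \<in> V" "0 \<le> t" "t \<le> 1"
  shows "u + t *\<^sub>R (v - u) \<in> V"
  using convexD_alt[OF assms] by (simp add: algebra_simps)

text \<open>
  Write \<open>y = u + s h\<close> and \<open>x = u0 + t (y - u0)\<close>. The derivative in \<open>s\<close> of the integrand
  \<open>ip (F x) (y - u0)\<close> is \<open>t * ip (DF x h) (y - u0) + ip (F x) h\<close>. By symmetry of \<open>DF x\<close> this is
  \<open>t * ip (DF x (y - u0)) h + ip (F x) h\<close>, the derivative of \<open>t * ip (F x) h\<close> with respect to \<open>t\<close>.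
  After differentiation under the integral sign, the integral over \<open>t\<close> therefore telescopes
  to \<open>ip (F y) h\<close>.
\<close>

lemma radial_potential_along_segment:
  assumes conv: "convex V" and sa: symmetric_derivative
    and u0: "u0 \<in> V" and u: "u \<in> V" and v: "v \<in> V" and h: "h = v - u" and s: "s \<in> {0..1}"
  shows "((\<lambda>s. radial_potential u0 C (u + s *\<^sub>R h)) has_real_derivative
           ip (F (u + s *\<^sub>R h)) h) (at s within {0..1})"
proof -
  let ?a = "u - u0"
  let ?x = "\<lambda>s t. u0 + t *\<^sub>R (u + s *\<^sub>R h - u0)"
  define G where "G = (\<lambda>s t. ip (F (?x s t)) (u + s *\<^sub>R h - u0))"
  \<comment> \<open>The second slot \<open>u + s h - u0\<close> is split into \<open>?a + s h\<close>, so that only products with fixed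
    vectors have to be differentiated.\<close>
  define G' where "G' = (\<lambda>s t. t * ip (DF (?x s t) h) ?a + t * s * ip (DF (?x s t) h) h + ip (F (?x s t)) h)"
  have carr [simp]: "u0 \<in> X" "u \<in> X" "h \<in> X" "?a \<in> X" "\<And>s. u + s *\<^sub>R h - u0 \<in> X"
    using u0 u v h by auto
  have y: "u + s *\<^sub>R h \<in> V" if "s \<in> {0..1}" for s
    using segment_in_domain[OF conv u v] that h by auto
  have x: "?x s t \<in> V" if "s \<in> {0..1}" "t \<in> {0..1}" for s t
    using segment_in_domain[OF conv u0 y] that by auto
  have split: "ip z (u + s *\<^sub>R h - u0) = ip z ?a + s * ip z h" if "z \<in> X" for z s
  proof -
    have "u + s *\<^sub>R h - u0 = ?a + s *\<^sub>R h" by simp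
    then show ?thesis using that by (simp only: add_right scale_right carr carrier)
  qed
  have dG: "((\<lambda>s. G s t) has_real_derivative G' s t) (at s within {0..1})"
    if s: "s \<in> {0..1}" and t: "t \<in> {0..1}" for s t
  proof -
    have x_eq: "?x s t = (u0 + t *\<^sub>R ?a) + s *\<^sub>R (t *\<^sub>R h)" for s
      by (simp add: algebra_simps)
    have line: "((\<lambda>s. ip (F (?x s t)) w) has_real_derivative t * ip (DF (?x s t) h) w) (at s within {0..1})"
      if w: "w \<in> X" for w
    proof -
      have "((\<lambda>s. ip (F ((u0 + t *\<^sub>R ?a) + s *\<^sub>R (t *\<^sub>R h))) w) has_real_derivative
          ip (DF ((u0 + t *\<^sub>R ?a) + s *\<^sub>R (t *\<^sub>R h)) (t *\<^sub>R h)) w) (at s within {0..1})"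
      proof (rule field_along_line)
        show "(u0 + t *\<^sub>R ?a) + s *\<^sub>R (t *\<^sub>R h) \<in> V" if "s \<in> {0..1}" for s
          using x[OF that t] by (simp only: x_eq)
      qed (use w s in auto)
      moreover have "ip (DF (?x s t) (t *\<^sub>R h)) w = t * ip (DF (?x s t) h) w"
        by (rule bounded_op_scale[OF derivative_bounded_op[OF x[OF s t]]]) (use w in auto)
      ultimately show ?thesis by (simp only: x_eq)
    qed
    have "((\<lambda>s. ip (F (?x s t)) ?a + s * ip (F (?x s t)) h) has_real_derivative G' s t) (at s within {0..1})"
      unfolding G'_def
      by (rule derivative_eq_intros line carr refl)+ (simp add: algebra_simps)
    then show ?thesis
      by (rule has_field_derivative_transform_within[OF _ zero_less_one s])
        (use x[OF _ t] in \<open>auto simp: G_def split\<close>)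
  qed
  have line_t: "((\<lambda>t. ip (F (?x s t)) w) has_real_derivative ip (DF (?x s t) (u + s *\<^sub>R h - u0)) w)
      (at t within {0..1})" if "s \<in> {0..1}" "t \<in> {0..1}" "w \<in> X" for s t w
    by (rule field_along_line) (use that x[OF that(1)] in auto)
  have int_G: "(G s) integrable_on cbox 0 1" if s: "s \<in> {0..1}" for s
  proof -
    have "continuous_on {0..1} (G s)"
      unfolding G_def by (rule DERIV_continuous_on) (rule line_t[OF s _ carr(5)])
    then show ?thesis by (simp add: integrable_continuous_interval)
  qed
  have cont: "continuous_on ({0..1} \<times> cbox 0 1) (\<lambda>(s, t). G' s t)"
    unfolding continuous_on_def
  proof
    fix z :: "real \<times> real" assume z: "z \<in> {0..1} \<times> cbox 0 1"
    let ?Fl = "at z within {0..1} \<times> cbox 0 1"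
    let ?\<Gamma> = "\<lambda>z. ?x (fst z) (snd z)"
    have zV: "?\<Gamma> z \<in> V" using z x by auto
    have ev: "\<forall>\<^sub>F z' in ?Fl. ?\<Gamma> z' \<in> V"
      unfolding eventually_at_topological using x by (intro exI[of _ UNIV]) auto
    have lim: "((\<lambda>z'. p (?\<Gamma> z' - ?\<Gamma> z)) \<longlongrightarrow> 0) ?Fl"
    proof (rule tendsto_sandwich[where f = "\<lambda>_. 0"])
      let ?b = "\<lambda>z'. \<bar>snd z' - snd z\<bar> * p ?a + \<bar>snd z' * fst z' - snd z * fst z\<bar> * p h"
      have "p (?\<Gamma> z' - ?\<Gamma> z) \<le> ?b z'" for z'
      proof -
        have eq: "?\<Gamma> z' - ?\<Gamma> z = (snd z' - snd z) *\<^sub>R ?a + (snd z' * fst z' - snd z * fst z) *\<^sub>R h"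
          by (simp add: algebra_simps)
        show ?thesis
          unfolding eq
          by (rule order_trans[OF seminorm_triangle]) (simp_all only: seminorm_scale carr carrier order_refl)
      qed
      then show "\<forall>\<^sub>F z' in ?Fl. p (?\<Gamma> z' - ?\<Gamma> z) \<le> ?b z'" by simp
      have "(?b \<longlongrightarrow> \<bar>snd z - snd z\<bar> * p ?a + \<bar>snd z * fst z - snd z * fst z\<bar> * p h) ?Fl"
        by (intro tendsto_intros)
      then show "(?b \<longlongrightarrow> 0) ?Fl" by simp
    qed auto
    have "((\<lambda>z'. G' (fst z') (snd z')) \<longlongrightarrow> G' (fst z) (snd z)) ?Fl"
      unfolding G'_def
      by (intro tendsto_intros ip_field_tendsto[OF zV ev lim] ip_derivative_tendsto[OF zV ev lim] carr)
    then show "((\<lambda>(s, t). G' s t) \<longlongrightarrow> (\<lambda>(s, t). G' s t) z) ?Fl"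
      by (simp add: case_prod_unfold)
  qed
  have "((\<lambda>s. integral (cbox 0 1) (G s)) has_real_derivative integral (cbox 0 1) (G' s)) (at s within {0..1})"
    by (rule leibniz_rule_field_derivative[OF _ int_G cont s]) (use dG in auto)
  moreover have "integral (cbox 0 1) (G' s) = ip (F (u + s *\<^sub>R h)) h"
  proof -
    have "(G' s has_integral 1 * ip (F (?x s 1)) h - 0 * ip (F (?x s 0)) h) {0..1}"
    proof (rule fundamental_theorem_of_calculus)
      fix t :: real assume t: "t \<in> {0..1}"
      have xt: "?x s t \<in> V" by (rule x[OF s t])
      have "ip (DF (?x s t) (u + s *\<^sub>R h - u0)) h = ip (DF (?x s t) h) (u + s *\<^sub>R h - u0)"
        using sa xt unfolding symmetric_derivative_def by (subst sym) auto
      also have "\<dots> = ip (DF (?x s t) h) ?a + s * ip (DF (?x s t) h) h"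
        by (rule split) (use xt in auto)
      finally have swap: "ip (DF (?x s t) (u + s *\<^sub>R h - u0)) h = ip (DF (?x s t) h) ?a + s * ip (DF (?x s t) h) h" .
      have "((\<lambda>t. t * ip (F (?x s t)) h) has_real_derivative G' s t) (at t within {0..1})"
        by (rule derivative_eq_intros line_t[OF s t carr(3)] refl)+
          (simp only: G'_def swap distrib_left mult_1_left mult_1_right mult_ac add_ac)
      then show "((\<lambda>t. t * ip (F (?x s t)) h) has_vector_derivative G' s t) (at t within {0..1})"
        by (simp add: has_real_derivative_iff_has_vector_derivative)
    qed simp
    then show ?thesis by (simp add: integral_unique)
  qed
  ultimately have "((\<lambda>s. C + integral (cbox 0 1) (G s)) has_real_derivative ip (F (u + s *\<^sub>R h)) h) (at s within {0..1})"
    by (auto intro!: derivative_eq_intros)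
  then show ?thesis
    by (simp add: radial_potential_def G_def)
qed

text \<open>
  By the previous lemma and the mean value theorem the increment of the potential from \<open>u\<close> to
  \<open>u + h\<close> is \<open>ip (F (u + \<xi> h)) h\<close> with \<open>\<xi>\<close> between \<open>0\<close> and \<open>1\<close>. It differs from
  \<open>ip (F u) h\<close> by \<open>o(p h)\<close> because \<open>F\<close> is continuous at \<open>u\<close>.
\<close>

theorem radial_potential_has_gradient:
  assumes conv: "convex V" and sa: symmetric_derivative and u0: "u0 \<in> V"
  shows "has_gradient (radial_potential u0 C)"
  unfolding has_gradient_def has_frechet_derivative_def
proof (intro ballI conjI allI impI)
  fix u assume u: "u \<in> V"
  then show "bounded_op X p UNIV abs (ip (F u))" by (intro bounded_op_ip) simp
  fix e :: real assume e: "0 < e"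
  obtain d where d: "0 < d" "\<And>v. v \<in> V \<Longrightarrow> p (v - u) < d \<Longrightarrow> p (F v - F u) < e"
    using field_continuous[OF u e] by blast
  show "\<exists>d>0. \<forall>v\<in>V. p (v - u) < d \<longrightarrow>
      \<bar>radial_potential u0 C v - radial_potential u0 C u - ip (F u) (v - u)\<bar> \<le> e * p (v - u)"
  proof (intro exI[of _ d] conjI ballI impI d(1))
    fix v assume v: "v \<in> V" "p (v - u) < d"
    define h where "h = v - u"
    have h: "h \<in> X" using u v by (simp add: h_def)
    let ?E = "\<lambda>s. radial_potential u0 C (u + s *\<^sub>R h)"
    have "\<exists>\<xi>\<in>{0..1}. ?E 1 - ?E 0 = (\<lambda>x. ip (F (u + \<xi> *\<^sub>R h)) h * x) (1 - 0)"
    proof (rule mvt_very_simple)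
      fix s :: real assume "0 \<le> s" "s \<le> 1"
      then show "(?E has_derivative (\<lambda>x. ip (F (u + s *\<^sub>R h)) h * x)) (at s within {0..1})"
        using radial_potential_along_segment[OF conv sa u0 u v(1) h_def, of s C]
        by (simp add: has_field_derivative_def)
    qed simp
    then obtain \<xi> where \<xi>: "0 \<le> \<xi>" "\<xi> \<le> 1"
      and E: "radial_potential u0 C v - radial_potential u0 C u = ip (F (u + \<xi> *\<^sub>R h)) h"
      by (auto simp: h_def)
    let ?w = "u + \<xi> *\<^sub>R h"
    have w: "?w \<in> V" using segment_in_domain[OF conv u v(1) \<xi>] by (simp add: h_def)
    have "p (?w - u) < d"
    proof -
      have "p (?w - u) = \<xi> * p h" using \<xi> h by (simp add: seminorm_scale)
      also have "\<dots> \<le> 1 * p h" using \<xi> h by (intro mult_right_mono) auto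
      finally show ?thesis using v by (simp add: h_def)
    qed
    then have small: "p (F ?w - F u) < e" by (rule d(2)[OF w])
    have "\<bar>ip (F ?w) h - ip (F u) h\<bar> = \<bar>ip (F ?w - F u) h\<bar>"
      using u w h by (simp only: diff_left field_carrier)
    also have "\<dots> \<le> p (F ?w - F u) * p h"
      using u w h by (intro Cauchy_Schwarz carrier field_carrier)
    also have "\<dots> \<le> e * p h" using small h by (intro mult_right_mono) auto
    finally show "\<bar>radial_potential u0 C v - radial_potential u0 C u - ip (F u) (v - u)\<bar> \<le> e * p (v - u)"
      by (simp only: E h_def)
  qed
qed


subsection \<open>A potential of a \<open>C\<^sup>1\<close> field is twice continuously differentiable\<close>

text \<open>
  The first derivative is \<open>u \<mapsto> ip (F u)\<close> and the second one \<open>u \<mapsto> (v \<mapsto> ip (DF u v))\<close>. Both inherit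
  their properties from \<open>F\<close> and \<open>DF\<close> because \<open>z \<mapsto> ip z\<close> does not increase seminorms.
\<close>

lemma gradient_C2:
  assumes E: "has_gradient E"
  shows "C2_functional X p V E"
proof -
  let ?Q = "op_seminorm X p abs"
  let ?D2E = "\<lambda>u v. ip (DF u v)"
  have dual: "ip z \<in> dual_carrier X p" if "z \<in> X" for z
    using bounded_op_ip[OF that] by (simp add: dual_carrier_def)
  have continuous_dual: "\<exists>d>0. \<forall>v\<in>V. p (v - u) < d \<longrightarrow> ?Q (ip (F v) - ip (F u)) < e"
    if u: "u \<in> V" and e: "0 < e" for u e
  proof -
    obtain d where d: "0 < d"
      "\<And>v. v \<in> V \<Longrightarrow> p (v - u) < d \<Longrightarrow> p (F v - F u) < e"
      using field_continuous[OF u e] by blast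
    show ?thesis
    proof (intro exI[of _ d] conjI ballI impI d(1))
      fix v assume v: "v \<in> V" "p (v - u) < d"
      have "?Q (ip (F v) - ip (F u)) \<le> p (F v - F u)"
        using u v by (intro functional_op_seminorm) (auto simp: diff_left)
      then show "?Q (ip (F v) - ip (F u)) < e" using d(2)[OF v] by simp
    qed
  qed
  have first: "C1_with_derivative X p UNIV abs V E (\<lambda>u. ip (F u))"
    using E continuous_dual unfolding C1_with_derivative_def has_gradient_def by blast
  have bounded: "bounded_op X p (dual_carrier X p) ?Q (?D2E u)" if u: "u \<in> V" for u
  proof -
    have "?Q (?D2E u (a *\<^sub>R v + b *\<^sub>R w) - (a *\<^sub>R ?D2E u v + b *\<^sub>R ?D2E u w)) = 0"
      if vw: "v \<in> X" "w \<in> X" for v w a b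
    proof -
      have "(?D2E u (a *\<^sub>R v + b *\<^sub>R w) - (a *\<^sub>R ?D2E u v + b *\<^sub>R ?D2E u w)) h = ip 0 h"
        if "h \<in> X" for h
        using bounded_op_linear[OF derivative_bounded_op[OF u] vw that] that
        by (simp add: scaleR_fun_def)
      then show ?thesis
        using functional_op_seminorm[of 0 "?D2E u (a *\<^sub>R v + b *\<^sub>R w) - (a *\<^sub>R ?D2E u v + b *\<^sub>R ?D2E u w)"]
        by (intro antisym) auto
    qed
    moreover obtain K where K: "\<And>v. v \<in> X \<Longrightarrow> p (DF u v) \<le> K * p v"
      using bounded_op_bound[OF derivative_bounded_op[OF u]] by metis
    have "?Q (?D2E u v) \<le> K * p v" if "v \<in> X" for v
      using functional_op_seminorm(1)[of "DF u v" "?D2E u v"] K[OF that] u that by simp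
    ultimately show ?thesis
      unfolding bounded_op_def using dual u by (auto intro!: exI[of _ K])
  qed
  have frechet2: "has_frechet_derivative X p (dual_carrier X p) ?Q V (\<lambda>u. ip (F u)) (?D2E u) u"
    if u: "u \<in> V" for u
    unfolding has_frechet_derivative_def
  proof (intro conjI allI impI bounded[OF u])
    fix e :: real assume "0 < e"
    then obtain d where d: "0 < d"
      "\<And>v. v \<in> V \<Longrightarrow> p (v - u) < d \<Longrightarrow> p (F v - F u - DF u (v - u)) \<le> e * p (v - u)"
      using frechet[OF u] by blast
    show "\<exists>d>0. \<forall>v\<in>V. p (v - u) < d \<longrightarrow> ?Q (ip (F v) - ip (F u) - ?D2E u (v - u)) \<le> e * p (v - u)"
    proof (intro exI[of _ d] conjI ballI impI d(1))
      fix v assume v: "v \<in> V" "p (v - u) < d"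
      have "?Q (ip (F v) - ip (F u) - ?D2E u (v - u)) \<le> p (F v - F u - DF u (v - u))"
        using u v by (intro functional_op_seminorm) (auto simp: diff_left)
      then show "?Q (ip (F v) - ip (F u) - ?D2E u (v - u)) \<le> e * p (v - u)"
        using d(2)[OF v] by simp
    qed
  qed
  have continuous2: "\<exists>d>0. \<forall>v\<in>V. p (v - u) < d \<longrightarrow> op_seminorm X p ?Q (?D2E v - ?D2E u) < e"
    if u: "u \<in> V" and e: "0 < e" for u e
  proof -
    obtain d where d: "0 < d"
      "\<And>v. v \<in> V \<Longrightarrow> p (v - u) < d \<Longrightarrow> op_seminorm X p p (DF v - DF u) < e"
      using C1 u e unfolding C1_with_derivative_def by metis
    show ?thesis
    proof (intro exI[of _ d] conjI ballI impI d(1))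
      fix v assume v: "v \<in> V" "p (v - u) < d"
      have D: "bounded_op X p X p (DF v - DF u)"
        using u v by (intro bounded_op_diff derivative_bounded_op)
      have "op_seminorm X p ?Q (?D2E v - ?D2E u) \<le> op_seminorm X p p (DF v - DF u)"
      proof (rule op_seminorm_le)
        fix h assume h: "h \<in> X" "p h \<le> 1"
        have "?Q ((?D2E v - ?D2E u) h) \<le> p ((DF v - DF u) h)"
          using u v h by (intro functional_op_seminorm) (auto simp: diff_left)
        also have "\<dots> \<le> op_seminorm X p p (DF v - DF u)"
          by (rule op_seminorm_upper[OF D h])
        finally show "?Q ((?D2E v - ?D2E u) h) \<le> op_seminorm X p p (DF v - DF u)" .
      qed
      then show "op_seminorm X p ?Q (?D2E v - ?D2E u) < e" using d(2)[OF v] by simp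
    qed
  qed
  have "C1_with_derivative X p (dual_carrier X p) ?Q V (\<lambda>u. ip (F u)) ?D2E"
    unfolding C1_with_derivative_def using frechet2 continuous2 dual by auto
  with first show ?thesis
    unfolding C2_functional_def by blast
qed

end


section \<open>Adjoints in a Hilbert space\<close>

text \<open>
  The vector \<open>z\<close> is the minimiser of the functional \<open>J x = (norm x)\<^sup>2 - 2 f x\<close>. The parallelogram law
  makes minimising sequences Cauchy, so completeness provides a minimiser, and the first-order
  condition at \<open>z\<close> says that \<open>f x = z \<bullet> x\<close>.
\<close>

theorem Riesz_representation:
  fixes f :: "'h::{real_inner, banach} \<Rightarrow> real"
  assumes f: "bounded_linear f"
  obtains z where "\<And>x. f x = z \<bullet> x"
proof -
  interpret f: bounded_linear f by (rule f)
  define J where "J x = (norm x)\<^sup>2 - 2 * f x" for x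
  obtain K where K: "\<And>x. \<bar>f x\<bar> \<le> norm x * K"
    using f.bounded by (auto simp: real_norm_def)
  have below: "- K\<^sup>2 \<le> J x" for x
    using K[of x] zero_le_power2[of "norm x - K"] by (auto simp: J_def power2_diff)
  then have bdd: "bdd_below (range J)" by (intro bdd_belowI2)
  define m where "m = Inf (range J)"
  have m_le: "m \<le> J x" for x unfolding m_def using bdd by (intro cInf_lower) auto
  have "\<exists>x. J x < m + 1 / real (Suc n)" for n
    using cInf_lessD[of "range J" "m + 1 / real (Suc n)"] by (auto simp: m_def)
  then obtain s where s: "\<And>n. J (s n) < m + 1 / real (Suc n)" by metis
  have parallelogram: "(norm (x - y))\<^sup>2 = 2 * J x + 2 * J y - 4 * J ((1/2) *\<^sub>R (x + y))" for x y
    unfolding J_def power2_norm_eq_inner f.add f.scaleR inner_add_left inner_add_right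
      inner_diff_left inner_diff_right inner_scaleR_left inner_scaleR_right
    by (simp add: inner_commute[of y x] field_simps)
  have "Cauchy s"
    unfolding Cauchy_def
  proof (intro allI impI)
    fix e :: real assume e: "0 < e"
    obtain N where N: "1 / real (Suc N) < e\<^sup>2 / 4"
      using nat_approx_posE[of "e\<^sup>2 / 4"] e by auto
    show "\<exists>N. \<forall>i\<ge>N. \<forall>j\<ge>N. dist (s i) (s j) < e"
    proof (intro exI[of _ N] allI impI)
      fix i j assume ij: "N \<le> i" "N \<le> j"
      have "1 / real (Suc i) \<le> 1 / real (Suc N)" "1 / real (Suc j) \<le> 1 / real (Suc N)"
        using ij by (auto intro!: divide_left_mono)
      then have "(norm (s i - s j))\<^sup>2 < e\<^sup>2"
        using s[of i] s[of j] m_le[of "(1/2) *\<^sub>R (s i + s j)"] N parallelogram[of "s i" "s j"] by linarith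
      then show "dist (s i) (s j) < e"
        using e by (simp add: dist_norm power2_less_imp_less)
    qed
  qed
  then obtain z where z: "s \<longlonglongrightarrow> z" by (auto simp: Cauchy_convergent_iff convergent_def)
  have "(\<lambda>n. J (s n)) \<longlonglongrightarrow> J z"
    unfolding J_def by (intro tendsto_intros f.tendsto z)
  moreover have "(\<lambda>n. m + 1 / real (Suc n)) \<longlonglongrightarrow> m"
    using tendsto_add[OF tendsto_const[of m] LIMSEQ_inverse_real_of_nat] by (simp add: inverse_eq_divide)
  ultimately have Jz: "J z \<le> m"
    using s by (intro LIMSEQ_le) (auto intro: less_imp_le)
  have "f x = z \<bullet> x" for x
  proof (cases "x = 0")
    case False
    define c where "c = z \<bullet> x - f x"
    define n where "n = (norm x)\<^sup>2"
    have n: "0 < n" using False by (simp add: n_def)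
    \<comment> \<open>The point on the line \<open>z + t x\<close> at which \<open>J\<close> is least.\<close>
    let ?t = "- c / n"
    have "J (z + t *\<^sub>R x) = J z + 2 * t * c + t\<^sup>2 * n" for t
      unfolding J_def c_def n_def power2_norm_eq_inner f.add f.scaleR inner_add_left inner_add_right
        inner_scaleR_left inner_scaleR_right
      by (simp add: inner_commute[of x z] algebra_simps power2_eq_square)
    then have "J (z + ?t *\<^sub>R x) = J z + 2 * ?t * c + ?t\<^sup>2 * n" .
    also have "\<dots> = J z - c\<^sup>2 / n"
      using n by (simp add: field_simps power2_eq_square)
    finally have "c\<^sup>2 / n \<le> 0" using m_le[of "z + ?t *\<^sub>R x"] Jz by linarith
    then have "c\<^sup>2 \<le> 0" using n by (simp add: divide_le_0_iff)
    then show ?thesis by (simp add: c_def)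
  qed (simp add: f.zero)
  then show ?thesis by (rule that)
qed

text \<open>
  The adjoint is defined by a choice operator. The representing vectors of \<open>x \<mapsto> T x \<bullet> y\<close>
  show that there is something to choose.
\<close>

lemma inner_adjoint:
  fixes T :: "'h::{real_inner, banach} \<Rightarrow>\<^sub>L 'h"
  shows "T x \<bullet> y = x \<bullet> adjoint T y"
proof -
  have "\<exists>z. \<forall>x. T x \<bullet> y = x \<bullet> z" for y
  proof -
    have "bounded_linear (\<lambda>x. T x \<bullet> y)"
      by (intro bounded_linear_inner_left_comp blinfun.bounded_linear_right)
    then obtain z where "\<And>x. T x \<bullet> y = z \<bullet> x" using Riesz_representation by blast
    then show ?thesis by (auto simp: inner_commute)
  qed
  then have "\<exists>T'. \<forall>x y. T x \<bullet> y = x \<bullet> T' y" by metis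
  then show ?thesis unfolding adjoint_def by (rule someI2_ex) auto
qed


section \<open>Square-integrable functions\<close>

lemma integrable_inner_L2:
  fixes u v :: "'w \<Rightarrow> 'h::{real_inner, second_countable_topology}"
  assumes u: "u \<in> L2 M" and v: "v \<in> L2 M"
  shows "integrable M (\<lambda>\<omega>. u \<omega> \<bullet> v \<omega>)"
proof (rule Bochner_Integration.integrable_bound)
  have [measurable]: "u \<in> borel_measurable M" "v \<in> borel_measurable M"
    using u v by (auto simp: L2_def)
  show "integrable M (\<lambda>\<omega>. (norm (u \<omega>))\<^sup>2 + (norm (v \<omega>))\<^sup>2)"
    using u v by (auto simp: L2_def)
  show "(\<lambda>\<omega>. u \<omega> \<bullet> v \<omega>) \<in> borel_measurable M" by measurable
  have "\<bar>u \<omega> \<bullet> v \<omega>\<bar> \<le> (norm (u \<omega>))\<^sup>2 + (norm (v \<omega>))\<^sup>2" for \<omega>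
    using Cauchy_Schwarz_ineq2[of "u \<omega>" "v \<omega>"] zero_le_power2[of "norm (u \<omega>) - norm (v \<omega>)"]
      zero_le_power2[of "norm (u \<omega>)"] zero_le_power2[of "norm (v \<omega>)"]
    unfolding power2_diff by linarith
  then show "AE \<omega> in M. norm (u \<omega> \<bullet> v \<omega>) \<le> norm ((norm (u \<omega>))\<^sup>2 + (norm (v \<omega>))\<^sup>2)"
    by simp
qed

lemma subspace_L2:
  fixes M :: "'w measure"
  shows "subspace (L2 M :: ('w \<Rightarrow> 'h::{real_inner, second_countable_topology}) set)"
  unfolding subspace_def
proof (intro conjI ballI allI)
  show "0 \<in> (L2 M :: ('w \<Rightarrow> 'h) set)" by (auto simp: L2_def zero_fun_def)
  fix u :: "'w \<Rightarrow> 'h" assume u: "u \<in> L2 M"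
  then show "c *\<^sub>R u \<in> L2 M" for c
    by (auto simp: L2_def scaleR_fun_def power_mult_distrib)
  fix v :: "'w \<Rightarrow> 'h" assume v: "v \<in> L2 M"
  have "integrable M (\<lambda>\<omega>. (norm (u \<omega>))\<^sup>2 + 2 * (u \<omega> \<bullet> v \<omega>) + (norm (v \<omega>))\<^sup>2)"
    using u v integrable_inner_L2[OF u v] by (auto simp: L2_def)
  then have "integrable M (\<lambda>\<omega>. (norm (u \<omega> + v \<omega>))\<^sup>2)"
    by (rule back_subst[where P = "integrable M"])
      (auto simp: power2_norm_eq_inner inner_add inner_commute)
  then show "u + v \<in> L2 M"
    using u v by (auto simp: L2_def plus_fun_def)
qed

lemma semi_inner_L2:
  fixes M :: "'w measure"
  shows "semi_inner (L2 M :: ('w \<Rightarrow> 'h::{real_inner, second_countable_topology}) set) (L2_inner M) (L2_norm M)"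
proof
  show "subspace (L2 M :: ('w \<Rightarrow> 'h) set)" by (rule subspace_L2)
  fix u v w :: "'w \<Rightarrow> 'h"
  show "L2_inner M u v = L2_inner M v u" by (simp add: L2_inner_def inner_commute)
  show "L2_norm M u = sqrt (L2_inner M u u)" by (simp add: L2_norm_def)
  show "0 \<le> L2_inner M u u" by (simp add: L2_inner_def)
  assume u: "u \<in> L2 M" and w: "w \<in> L2 M"
  show "L2_inner M (c *\<^sub>R u) w = c * L2_inner M u w" for c
    by (simp add: L2_inner_def scaleR_fun_def)
  assume v: "v \<in> L2 M"
  show "L2_inner M (u + v) w = L2_inner M u w + L2_inner M v w"
    using u v w by (simp add: L2_inner_def inner_add_left integrable_inner_L2)
qed


subsection \<open>Multiplication by operator fields\<close>

text \<open>
  The field is measurable in \<open>\<omega>\<close> for a fixed vector and continuous in the vector for fixed \<open>\<omega>\<close>.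
  For a simple function \<open>u\<close> only finitely many vectors occur; the general case is a pointwise
  limit of this one.
\<close>

lemma strong_Linf_apply_measurable:
  fixes A :: "'w \<Rightarrow> 'h::{real_normed_vector, second_countable_topology} \<Rightarrow>\<^sub>L 'h"
  assumes A: "A \<in> strong_Linf M" and u: "u \<in> borel_measurable M"
  shows "(\<lambda>\<omega>. A \<omega> (u \<omega>)) \<in> borel_measurable M"
proof -
  obtain s where s: "\<And>i. simple_function M (s i)" "\<And>\<omega>. \<omega> \<in> space M \<Longrightarrow> (\<lambda>i. s i \<omega>) \<longlonglongrightarrow> u \<omega>"
    using borel_measurable_implies_sequence_metric[OF u, of 0] by blast
  have "(\<lambda>\<omega>. A \<omega> (s i \<omega>)) \<in> borel_measurable M" for i
  proof (rule measurable_compose_countable'[where f = "\<lambda>x \<omega>. A \<omega> x" and g = "s i" and I = "s i ` space M"])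
    show "(\<lambda>\<omega>. A \<omega> x) \<in> borel_measurable M" for x
      using A by (simp add: strong_Linf_def)
    show "countable (s i ` space M)"
      using simple_functionD(1)[OF s(1)] by (rule countable_finite)
    show "s i \<in> M \<rightarrow>\<^sub>M count_space (s i ` space M)"
      using simple_functionD[OF s(1)] by (auto simp: measurable_count_space_eq2)
  qed
  then show ?thesis
    by (rule borel_measurable_LIMSEQ_metric) (auto intro!: blinfun.tendsto s(2))
qed

lemma strong_Linf_apply_L2:
  assumes A: "A \<in> strong_Linf M" and u: "u \<in> L2 M"
  shows "(\<lambda>\<omega>. A \<omega> (u \<omega>)) \<in> L2 M"
proof -
  have meas: "(\<lambda>\<omega>. A \<omega> (u \<omega>)) \<in> borel_measurable M"
    using strong_Linf_apply_measurable[OF A] u by (simp add: L2_def)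
  obtain C where C: "AE \<omega> in M. norm (A \<omega>) \<le> C" using A by (auto simp: strong_Linf_def)
  have "integrable M (\<lambda>\<omega>. (norm (A \<omega> (u \<omega>)))\<^sup>2)"
  proof (rule Bochner_Integration.integrable_bound)
    show "integrable M (\<lambda>\<omega>. C\<^sup>2 * (norm (u \<omega>))\<^sup>2)" using u by (auto simp: L2_def)
    show "(\<lambda>\<omega>. (norm (A \<omega> (u \<omega>)))\<^sup>2) \<in> borel_measurable M" using meas by measurable
    show "AE \<omega> in M. norm ((norm (A \<omega> (u \<omega>)))\<^sup>2) \<le> norm (C\<^sup>2 * (norm (u \<omega>))\<^sup>2)"
      using C
    proof eventually_elim
      case (elim \<omega>)
      have "norm (A \<omega> (u \<omega>)) \<le> norm (A \<omega>) * norm (u \<omega>)" by (rule norm_blinfun)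
      also have "\<dots> \<le> C * norm (u \<omega>)" using elim by (intro mult_right_mono) auto
      finally have "(norm (A \<omega> (u \<omega>)))\<^sup>2 \<le> (C * norm (u \<omega>))\<^sup>2" by (intro power_mono) auto
      then show ?case by (simp add: power_mult_distrib)
    qed
  qed
  with meas show ?thesis by (simp add: L2_def)
qed

lemma (in finite_measure) indicator_L2:
  fixes x :: "'h::{real_inner, second_countable_topology}"
  assumes "Q \<in> sets M"
  shows "(\<lambda>\<omega>. indicator Q \<omega> *\<^sub>R x) \<in> L2 M"
proof -
  have "integrable M (\<lambda>\<omega>. indicator Q \<omega> * (norm x)\<^sup>2)"
    using assms by (intro integrable_mult_left integrable_real_indicator) (auto simp: less_top[symmetric])
  then have "integrable M (\<lambda>\<omega>. (norm (indicator Q \<omega> *\<^sub>R x))\<^sup>2)"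
    by (rule back_subst[where P = "integrable M"]) (auto simp: indicator_def fun_eq_iff)
  then show ?thesis using assms by (simp add: L2_def)
qed


section \<open>Iterates of an automorphism\<close>

locale automorphism = prob_space M for M :: "'w measure" +
  fixes \<theta> :: "'w \<Rightarrow> 'w"
  assumes mp_automorphism: "mp_automorphism M \<theta>"
begin

lemma funpow_preserving:
  assumes f: "f \<in> M \<rightarrow>\<^sub>M M" and d: "distr M M f = M"
  shows "(f ^^ n) \<in> M \<rightarrow>\<^sub>M M" "distr M M (f ^^ n) = M"
proof (induction n)
  case 0
  show "(f ^^ 0) \<in> M \<rightarrow>\<^sub>M M" by (simp add: id_def)
  show "distr M M (f ^^ 0) = M" by (simp add: id_def)
next
  case (Suc n)
  show "(f ^^ Suc n) \<in> M \<rightarrow>\<^sub>M M" using Suc f by (simp add: measurable_comp)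
  show "distr M M (f ^^ Suc n) = M"
    using distr_distr[OF f Suc(1)] d Suc(2) by simp
qed

lemma inverse_eq:
  "\<omega> \<in> space M \<Longrightarrow> \<theta> (inv_into (space M) \<theta> \<omega>) = \<omega>"
  "\<omega> \<in> space M \<Longrightarrow> inv_into (space M) \<theta> (\<theta> \<omega>) = \<omega>"
  using mp_automorphism
  by (auto simp: mp_automorphism_def bij_betw_inv_into_right bij_betw_inv_into_left)

lemma
  shows \<theta>_measurable: "\<theta> \<in> M \<rightarrow>\<^sub>M M" and \<theta>_distr: "distr M M \<theta> = M"
    and inverse_measurable: "inv_into (space M) \<theta> \<in> M \<rightarrow>\<^sub>M M"
  using mp_automorphism by (auto simp: mp_automorphism_def)

lemma inverse_distr: "distr M M (inv_into (space M) \<theta>) = M"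
proof -
  let ?g = "inv_into (space M) \<theta>"
  have "distr M M ?g = distr (distr M M \<theta>) M ?g" by (simp add: \<theta>_distr)
  also have "\<dots> = distr M M (?g \<circ> \<theta>)" by (rule distr_distr[OF inverse_measurable \<theta>_measurable])
  also have "\<dots> = distr M M id" by (rule distr_cong) (auto simp: inverse_eq)
  finally show ?thesis by (simp add: id_def)
qed

lemma iter_measurable [measurable]: "iter M \<theta> k \<in> M \<rightarrow>\<^sub>M M"
  unfolding iter_def
  using funpow_preserving(1)[OF \<theta>_measurable \<theta>_distr] funpow_preserving(1)[OF inverse_measurable inverse_distr]
  by auto

lemma iter_distr: "distr M M (iter M \<theta> k) = M"
  unfolding iter_def
  using funpow_preserving(2)[OF \<theta>_measurable \<theta>_distr] funpow_preserving(2)[OF inverse_measurable inverse_distr]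
  by auto

lemma funpow_inverse:
  assumes f: "f \<in> M \<rightarrow>\<^sub>M M" and g: "g \<in> M \<rightarrow>\<^sub>M M" and fg: "\<And>\<omega>. \<omega> \<in> space M \<Longrightarrow> f (g \<omega>) = \<omega>"
    and \<omega>: "\<omega> \<in> space M"
  shows "(f ^^ n) ((g ^^ n) \<omega>) = \<omega>"
proof (induction n)
  case (Suc n)
  have "(g ^^ n) \<omega> \<in> space M"
    by (induction n) (use \<omega> g in \<open>auto dest: measurable_space\<close>)
  then have "(f ^^ Suc n) ((g ^^ Suc n) \<omega>) = (f ^^ n) ((g ^^ n) \<omega>)"
    by (simp add: funpow_swap1[of f] fg)
  then show ?case using Suc by simp
qed simp

lemma iter_iter_minus: "\<omega> \<in> space M \<Longrightarrow> iter M \<theta> k (iter M \<theta> (- k) \<omega>) = \<omega>"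
  unfolding iter_def
  using funpow_inverse[OF \<theta>_measurable inverse_measurable inverse_eq(1)]
    funpow_inverse[OF inverse_measurable \<theta>_measurable inverse_eq(2)]
  by auto

lemma integral_iter:
  assumes "f \<in> borel_measurable M"
  shows "(\<integral>\<omega>. f (iter M \<theta> k \<omega>) \<partial>M) = (\<integral>\<omega>. (f \<omega> :: real) \<partial>M)"
  using integral_distr[OF iter_measurable assms, of k] by (simp add: iter_distr)

lemma integrable_iter:
  assumes "f \<in> borel_measurable M"
  shows "integrable M (\<lambda>\<omega>. f (iter M \<theta> k \<omega>) :: real) \<longleftrightarrow> integrable M f"
  using integrable_distr_eq[OF iter_measurable assms, of k] by (simp add: iter_distr)

lemma iter_L2:
  assumes "v \<in> L2 M"
  shows "(\<lambda>\<omega>. v (iter M \<theta> k \<omega>)) \<in> L2 M"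
  using assms integrable_iter[of "\<lambda>\<omega>. (norm (v \<omega>))\<^sup>2" k]
  by (auto simp: L2_def intro: measurable_compose[OF iter_measurable])


subsection \<open>Separation of the iterates\<close>

text \<open>
  A countable base of the underlying metrizable topology: the complement of the finite set \<open>T\<close> is
  open. Completing the measure keeps the base measurable.
\<close>

lemma separating_sequence_of_sets:
  assumes "standard_prob_space M"
  obtains \<B> where "countable \<B>" "\<B> \<subseteq> sets M"
    "\<And>x T. x \<in> space M \<Longrightarrow> finite T \<Longrightarrow> T \<subseteq> space M \<Longrightarrow> x \<notin> T \<Longrightarrow> \<exists>Q\<in>\<B>. x \<in> Q \<and> Q \<inter> T = {}"
proof -
  obtain N where N: "standard_borel N" and MN: "M = N \<or> M = completion N"
    using assms by (auto simp: standard_prob_space_def)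
  obtain X where X: "topspace X = space N" "completely_metrizable_space X" "second_countable X"
    "sets N = sigma_sets (space N) {U. openin X U}"
    using N by (auto simp: standard_borel_def)
  obtain \<B> where \<B>: "countable \<B>" "\<And>U. U \<in> \<B> \<Longrightarrow> openin X U"
    "\<And>U x. openin X U \<Longrightarrow> x \<in> U \<Longrightarrow> \<exists>Q\<in>\<B>. x \<in> Q \<and> Q \<subseteq> U"
    using X(3) unfolding second_countable_def by metis
  have "\<B> \<subseteq> sets N" using \<B>(2) by (auto simp: X(4) intro: sigma_sets.Basic)
  then have "\<B> \<subseteq> sets M" using MN by (auto intro: sets_completionI_sets)
  moreover have "\<exists>Q\<in>\<B>. x \<in> Q \<and> Q \<inter> T = {}"
    if "x \<in> space M" "finite T" "T \<subseteq> space M" "x \<notin> T" for x T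
  proof -
    have space: "space M = topspace X" using MN by (auto simp: X(1))
    have "Hausdorff_space X"
      using X(2) by (simp add: completely_metrizable_imp_metrizable_space metrizable_imp_Hausdorff_space)
    then have "closedin X T"
      using that by (simp add: space finite_imp_closedin t1_space Hausdorff_imp_t1_space closedin_Hausdorff_finite)
    then have "openin X (topspace X - T)" by blast
    then show ?thesis using \<B>(3)[of "topspace X - T" x] that by (auto simp: space)
  qed
  ultimately show ?thesis using \<B>(1) by (intro that)
qed

text \<open>
  Composition operators along almost everywhere distinct iterates are linearly independent, even with
  functions as coefficients. Let \<open>P Q\<close> be the set of points whose \<open>k\<close>-th iterate lies in \<open>Q\<close>
  while no other iterate does. Testing with \<open>Q\<close> and with subsets of \<open>P Q\<close> isolates the \<open>k\<close>-th term
  and shows \<open>f k = 0\<close> almost everywhere on \<open>P Q\<close>. Since the iterates are distinct, the sets \<open>P Q\<close>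
  with \<open>Q\<close> from a countable separating family cover almost all of the space.
\<close>

lemma weighted_iterates_independent:
  fixes f :: "int \<Rightarrow> 'w \<Rightarrow> real"
  assumes standard: "standard_prob_space M" and fin: "finite R"
    and free: "\<And>k l. k \<in> R \<Longrightarrow> l \<in> R \<Longrightarrow> k \<noteq> l \<Longrightarrow>
      {\<omega> \<in> space M. iter M \<theta> k \<omega> = iter M \<theta> l \<omega>} \<in> null_sets M"
    and f: "\<And>k. k \<in> R \<Longrightarrow> integrable M (f k)"
    and zero: "\<And>Q C. Q \<in> sets M \<Longrightarrow> C \<in> sets M \<Longrightarrow>
      (\<integral>\<omega>. (\<Sum>k\<in>R. indicator Q (iter M \<theta> k \<omega>) * (indicator C \<omega> * f k \<omega>)) \<partial>M) = 0"
    and k: "k \<in> R"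
  shows "AE \<omega> in M. f k \<omega> = 0"
proof -
  obtain \<B> where \<B>: "countable \<B>" "\<B> \<subseteq> sets M"
    "\<And>x T. x \<in> space M \<Longrightarrow> finite T \<Longrightarrow> T \<subseteq> space M \<Longrightarrow> x \<notin> T \<Longrightarrow> \<exists>Q\<in>\<B>. x \<in> Q \<and> Q \<inter> T = {}"
    using separating_sequence_of_sets[OF standard] by blast
  define P where "P Q = {\<omega> \<in> space M. iter M \<theta> k \<omega> \<in> Q \<and> (\<forall>l\<in>R - {k}. iter M \<theta> l \<omega> \<notin> Q)}" for Q
  have P_sets: "P Q \<in> sets M" if [measurable]: "Q \<in> sets M" for Q
  proof -
    have [measurable]: "countable (R - {k})" using fin by (simp add: countable_finite)
    show ?thesis unfolding P_def by measurable
  qed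
  have local: "AE \<omega> in M. indicator (P Q) \<omega> * f k \<omega> = 0" if Q: "Q \<in> sets M" for Q
  proof -
    have fP: "integrable M (\<lambda>\<omega>. indicator (P Q) \<omega> * f k \<omega>)"
      using integrable_mult_indicator[OF P_sets[OF Q] f[OF k]] by simp
    have "AE \<omega> in M. (\<lambda>\<omega>. indicator (P Q) \<omega> * f k \<omega>) \<omega> = 0"
    proof (rule density_zero[OF fP])
      fix C assume C: "C \<in> sets M"
      have PC: "P Q \<inter> C \<in> sets M" using P_sets[OF Q] C by auto
      have "(\<Sum>l\<in>R. indicator Q (iter M \<theta> l \<omega>) * (indicator (P Q \<inter> C) \<omega> * f l \<omega>))
          = indicator C \<omega> *\<^sub>R (indicator (P Q) \<omega> * f k \<omega>)" for \<omega>
      proof -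
        have "(\<Sum>l\<in>R. indicator Q (iter M \<theta> l \<omega>) * (indicator (P Q \<inter> C) \<omega> * f l \<omega>))
          = (\<Sum>l\<in>R. if l = k then indicator C \<omega> * (indicator (P Q) \<omega> * f k \<omega>) else 0)"
          by (rule sum.cong) (auto simp: P_def indicator_def)
        then show ?thesis using fin k by simp
      qed
      then show "set_lebesgue_integral M C (\<lambda>\<omega>. indicator (P Q) \<omega> * f k \<omega>) = 0"
        using zero[OF Q PC] by (simp add: set_lebesgue_integral_def)
    qed
    then show ?thesis .
  qed
  have "AE \<omega> in M. \<forall>Q\<in>\<B>. indicator (P Q) \<omega> * f k \<omega> = 0"
    using local \<B>(1,2) by (intro AE_ball_countable') auto
  moreover have "AE \<omega> in M. \<forall>l\<in>R - {k}. iter M \<theta> k \<omega> \<noteq> iter M \<theta> l \<omega>"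
  proof (rule AE_finite_allI)
    fix l assume "l \<in> R - {k}"
    then show "AE \<omega> in M. iter M \<theta> k \<omega> \<noteq> iter M \<theta> l \<omega>"
      using AE_not_in[OF free[OF k, of l]] by (auto elim!: AE_mp intro!: AE_I2)
  qed (use fin in auto)
  moreover note AE_space
  ultimately show ?thesis
  proof eventually_elim
    case (elim \<omega>)
    have it: "iter M \<theta> l \<omega> \<in> space M" for l
      using elim(3) by (rule measurable_space[OF iter_measurable])
    have "\<exists>Q\<in>\<B>. iter M \<theta> k \<omega> \<in> Q \<and> Q \<inter> (\<lambda>l. iter M \<theta> l \<omega>) ` (R - {k}) = {}"
      using elim(2) fin it by (intro \<B>(3)) auto
    then obtain Q where "Q \<in> \<B>" "\<omega> \<in> P Q" using elim(3) by (auto simp: P_def)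
    then show ?case using elim(1) by auto
  qed
qed

end


section \<open>Self-adjoint memory operators\<close>

context automorphism
begin

text \<open>
  The condition \<open>a k \<omega> = (a (- k) (\<theta>\<^sup>k \<omega>))\<^sup>*\<close> says that this form vanishes. For fixed vectors the
  form is a real function of \<open>\<omega>\<close> that can be integrated.
\<close>

definition defect_form ::
  "(int \<Rightarrow> 'w \<Rightarrow> ('h::real_inner \<Rightarrow>\<^sub>L 'h)) \<Rightarrow> int \<Rightarrow> 'w \<Rightarrow> 'h \<Rightarrow> 'h \<Rightarrow> real" where
  "defect_form a k \<omega> x y = a k \<omega> x \<bullet> y - x \<bullet> a (- k) (iter M \<theta> k \<omega>) y"

text \<open>
  The measure is invariant under \<open>\<theta>\<^sup>k\<close>; the substitution \<open>\<omega> \<mapsto> \<theta>\<^sup>k \<omega>\<close> moves the shift from \<open>w\<close> to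
  \<open>v\<close>. In other words, the adjoint of an operator that shifts by \<open>- k\<close> shifts by \<open>k\<close>.
\<close>

lemma
  fixes a :: "int \<Rightarrow> 'w \<Rightarrow> ('h::{real_inner, second_countable_topology} \<Rightarrow>\<^sub>L 'h)"
  assumes a: "a k \<in> strong_Linf M" "a (- k) \<in> strong_Linf M" and v: "v \<in> L2 M" and w: "w \<in> L2 M"
  shows integrable_forward: "integrable M (\<lambda>\<omega>. a k \<omega> (v (iter M \<theta> k \<omega>)) \<bullet> w \<omega>)"
    and integrable_backward: "integrable M (\<lambda>\<omega>. v (iter M \<theta> k \<omega>) \<bullet> a (- k) (iter M \<theta> k \<omega>) (w \<omega>))"
    and integral_backward: "(\<integral>\<omega>. a (- k) \<omega> (w (iter M \<theta> (- k) \<omega>)) \<bullet> v \<omega> \<partial>M)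
      = (\<integral>\<omega>. v (iter M \<theta> k \<omega>) \<bullet> a (- k) (iter M \<theta> k \<omega>) (w \<omega>) \<partial>M)"
proof -
  show "integrable M (\<lambda>\<omega>. a k \<omega> (v (iter M \<theta> k \<omega>)) \<bullet> w \<omega>)"
    by (intro integrable_inner_L2 strong_Linf_apply_L2 a iter_L2 v w)
  let ?g = "\<lambda>\<omega>. a (- k) \<omega> (w (iter M \<theta> (- k) \<omega>)) \<bullet> v \<omega>"
  have g: "integrable M ?g"
    by (intro integrable_inner_L2 strong_Linf_apply_L2 a iter_L2 v w)
  then have meas: "?g \<in> borel_measurable M" by auto
  have eq: "?g (iter M \<theta> k \<omega>) = v (iter M \<theta> k \<omega>) \<bullet> a (- k) (iter M \<theta> k \<omega>) (w \<omega>)"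
    if "\<omega> \<in> space M" for \<omega>
    using iter_iter_minus[OF that, of "- k"] by (simp add: inner_commute)
  show "integrable M (\<lambda>\<omega>. v (iter M \<theta> k \<omega>) \<bullet> a (- k) (iter M \<theta> k \<omega>) (w \<omega>))"
    using integrable_iter[OF meas, of k] g eq by (simp cong: Bochner_Integration.integrable_cong)
  show "(\<integral>\<omega>. ?g \<omega> \<partial>M) = (\<integral>\<omega>. v (iter M \<theta> k \<omega>) \<bullet> a (- k) (iter M \<theta> k \<omega>) (w \<omega>) \<partial>M)"
    unfolding integral_iter[OF meas, of k, symmetric] by (rule Bochner_Integration.integral_cong[OF refl eq])
qed

lemma integrable_defect_form:
  fixes a :: "int \<Rightarrow> 'w \<Rightarrow> ('h::{real_inner, second_countable_topology} \<Rightarrow>\<^sub>L 'h)"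
  assumes "a k \<in> strong_Linf M" "a (- k) \<in> strong_Linf M" "v \<in> L2 M" "w \<in> L2 M"
  shows "integrable M (\<lambda>\<omega>. defect_form a k \<omega> (v (iter M \<theta> k \<omega>)) (w \<omega>))"
  unfolding defect_form_def
  by (rule Bochner_Integration.integrable_diff[OF integrable_forward[of a k v w, OF assms]
        integrable_backward[of a k v w, OF assms]])

text \<open>
  Both products are expanded over \<open>R\<close>. Reindexing the second sum by \<open>k \<mapsto> - k\<close>, which needs \<open>R\<close>
  symmetric, and substituting as above pairs the terms that carry the same shift of \<open>v\<close>.
\<close>

lemma self_adjointness_defect:
  fixes a :: "int \<Rightarrow> 'w \<Rightarrow> ('h::{real_inner, second_countable_topology} \<Rightarrow>\<^sub>L 'h)"
  assumes fin: "finite R" and symR: "\<And>k. k \<in> R \<Longrightarrow> - k \<in> R"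
    and a: "\<And>k. k \<in> R \<Longrightarrow> a k \<in> strong_Linf M"
    and D: "\<And>v. v \<in> L2 M \<Longrightarrow> D v \<in> L2 M"
    and D_eq: "\<And>v. v \<in> L2 M \<Longrightarrow> AE \<omega> in M. D v \<omega> = (\<Sum>k\<in>R. a k \<omega> (v (iter M \<theta> k \<omega>)))"
    and v: "v \<in> L2 M" and w: "w \<in> L2 M"
  shows "L2_inner M (D v) w - L2_inner M v (D w)
    = (\<integral>\<omega>. (\<Sum>k\<in>R. defect_form a k \<omega> (v (iter M \<theta> k \<omega>)) (w \<omega>)) \<partial>M)"
proof -
  have expand: "L2_inner M (D v) w = (\<Sum>k\<in>R. \<integral>\<omega>. a k \<omega> (v (iter M \<theta> k \<omega>)) \<bullet> w \<omega> \<partial>M)"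
    if v: "v \<in> L2 M" and w: "w \<in> L2 M" for v w
  proof -
    have int: "integrable M (\<lambda>\<omega>. a k \<omega> (v (iter M \<theta> k \<omega>)) \<bullet> w \<omega>)" if "k \<in> R" for k
      by (rule integrable_forward[of a k v w]) (fact a[OF that] a[OF symR[OF that]] v w)+
    have "L2_inner M (D v) w = (\<integral>\<omega>. (\<Sum>k\<in>R. a k \<omega> (v (iter M \<theta> k \<omega>)) \<bullet> w \<omega>) \<partial>M)"
      unfolding L2_inner_def
    proof (rule integral_cong_AE)
      show "(\<lambda>\<omega>. D v \<omega> \<bullet> w \<omega>) \<in> borel_measurable M"
        using integrable_inner_L2[OF D[OF v] w] by auto
      show "(\<lambda>\<omega>. \<Sum>k\<in>R. a k \<omega> (v (iter M \<theta> k \<omega>)) \<bullet> w \<omega>) \<in> borel_measurable M"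
        using int by (intro borel_measurable_sum borel_measurable_integrable) auto
      show "AE \<omega> in M. D v \<omega> \<bullet> w \<omega> = (\<Sum>k\<in>R. a k \<omega> (v (iter M \<theta> k \<omega>)) \<bullet> w \<omega>)"
        using D_eq[OF v] by eventually_elim (simp add: inner_sum_left)
    qed
    also have "\<dots> = (\<Sum>k\<in>R. \<integral>\<omega>. a k \<omega> (v (iter M \<theta> k \<omega>)) \<bullet> w \<omega> \<partial>M)"
      using int by (intro Bochner_Integration.integral_sum) auto
    finally show ?thesis .
  qed
  have "L2_inner M v (D w) = L2_inner M (D w) v"
    by (simp add: L2_inner_def inner_commute)
  also have "\<dots> = (\<Sum>k\<in>R. \<integral>\<omega>. a k \<omega> (w (iter M \<theta> k \<omega>)) \<bullet> v \<omega> \<partial>M)"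
    by (rule expand[OF w v])
  also have "\<dots> = (\<Sum>k\<in>R. \<integral>\<omega>. a (- k) \<omega> (w (iter M \<theta> (- k) \<omega>)) \<bullet> v \<omega> \<partial>M)"
    by (rule sum.reindex_bij_witness[of _ uminus uminus]) (auto simp: symR)
  also have "\<dots> = (\<Sum>k\<in>R. \<integral>\<omega>. v (iter M \<theta> k \<omega>) \<bullet> a (- k) (iter M \<theta> k \<omega>) (w \<omega>) \<partial>M)"
    by (rule sum.cong[OF refl], rule integral_backward[of a]) (auto intro: a symR v w)
  finally have backward: "L2_inner M v (D w) = \<dots>" .
  have "L2_inner M (D v) w - L2_inner M v (D w)
    = (\<Sum>k\<in>R. \<integral>\<omega>. defect_form a k \<omega> (v (iter M \<theta> k \<omega>)) (w \<omega>) \<partial>M)"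
    unfolding expand[OF v w] backward defect_form_def sum_subtractf[symmetric]
    by (rule sum.cong[OF refl], rule Bochner_Integration.integral_diff[symmetric],
        rule integrable_forward[of a], auto intro: a symR v w,
        rule integrable_backward[of a], auto intro: a symR v w)
  also have "\<dots> = (\<integral>\<omega>. (\<Sum>k\<in>R. defect_form a k \<omega> (v (iter M \<theta> k \<omega>)) (w \<omega>)) \<partial>M)"
    by (rule Bochner_Integration.integral_sum[symmetric], rule integrable_defect_form[of a])
      (auto intro: a symR v w)
  finally show ?thesis .
qed

lemma defect_form_eq_zero_if_dense:
  fixes a :: "int \<Rightarrow> 'w \<Rightarrow> ('h::real_inner \<Rightarrow>\<^sub>L 'h)"
  assumes dense: "\<And>U :: 'h set. open U \<Longrightarrow> U \<noteq> {} \<Longrightarrow> \<exists>d\<in>Y. d \<in> U"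
    and zero: "\<And>x y. x \<in> Y \<Longrightarrow> y \<in> Y \<Longrightarrow> defect_form a k \<omega> x y = 0"
  shows "defect_form a k \<omega> x y = 0"
proof -
  have extend: "g x = 0" if g: "continuous_on UNIV g" and zero: "\<And>d. d \<in> Y \<Longrightarrow> g d = 0"
    for g :: "'h \<Rightarrow> real" and x
  proof (rule ccontr)
    assume "g x \<noteq> 0"
    moreover have "open {x. g x \<noteq> 0}" by (intro open_Collect_neq g continuous_on_const)
    ultimately show False using dense[of "{x. g x \<noteq> 0}"] zero by auto
  qed
  have left: "defect_form a k \<omega> x y = 0" if y: "y \<in> Y" for x y
  proof (rule extend[of "\<lambda>x. defect_form a k \<omega> x y"])
    show "continuous_on UNIV (\<lambda>x. defect_form a k \<omega> x y)"
      unfolding defect_form_def by (intro continuous_intros)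
  qed (rule zero[OF _ y])
  show ?thesis
  proof (rule extend[of "defect_form a k \<omega> x"])
    show "continuous_on UNIV (defect_form a k \<omega> x)"
      unfolding defect_form_def by (intro continuous_intros)
  qed (rule left)
qed

text \<open>
  If \<open>D\<close> is self-adjoint, the defect vanishes for \<open>v = 1\<^sub>Q x\<close> and \<open>w = 1\<^sub>C y\<close>; independence of the
  iterates then gives \<open>defect_form a k \<omega> x y = 0\<close> for almost every \<open>\<omega>\<close>. The exceptional set depends
  on \<open>x\<close> and \<open>y\<close>, and separability of the Hilbert space is used to choose one set for all vectors. For the
  converse, the existence of adjoints makes the forms vanish, and the defect is their integral.
\<close>

theorem self_adjoint_iff_coefficients:
  fixes a :: "int \<Rightarrow> 'w \<Rightarrow> ('h::{real_inner, banach, second_countable_topology} \<Rightarrow>\<^sub>L 'h)"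
  assumes standard: "standard_prob_space M" and fin: "finite R" and symR: "\<And>k. k \<in> R \<Longrightarrow> - k \<in> R"
    and free: "\<And>k l. k \<in> R \<Longrightarrow> l \<in> R \<Longrightarrow> k \<noteq> l \<Longrightarrow>
      {\<omega> \<in> space M. iter M \<theta> k \<omega> = iter M \<theta> l \<omega>} \<in> null_sets M"
    and a: "\<And>k. k \<in> R \<Longrightarrow> a k \<in> strong_Linf M"
    and D: "bounded_op (L2 M) (L2_norm M) (L2 M) (L2_norm M) D"
    and D_eq: "\<And>v. v \<in> L2 M \<Longrightarrow> AE \<omega> in M. D v \<omega> = (\<Sum>k\<in>R. a k \<omega> (v (iter M \<theta> k \<omega>)))"
  shows "L2_self_adjoint M D \<longleftrightarrow>
    (\<forall>k\<in>R. AE \<omega> in M. blinfun_apply (a k \<omega>) = adjoint (a (- k) (iter M \<theta> k \<omega>)))"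
proof
  have carrier: "D v \<in> L2 M" if "v \<in> L2 M" for v
    using D that by (auto simp: bounded_op_def)
  have defect: "L2_inner M (D v) w - L2_inner M v (D w)
      = (\<integral>\<omega>. (\<Sum>k\<in>R. defect_form a k \<omega> (v (iter M \<theta> k \<omega>)) (w \<omega>)) \<partial>M)"
    if "v \<in> L2 M" "w \<in> L2 M" for v w
    by (rule self_adjointness_defect) (fact fin symR a carrier D_eq that)+
  show "\<forall>k\<in>R. AE \<omega> in M. blinfun_apply (a k \<omega>) = adjoint (a (- k) (iter M \<theta> k \<omega>))"
    if sa: "L2_self_adjoint M D"
  proof
    fix k assume k: "k \<in> R"
    obtain Y :: "'h set" where Y: "countable Y" "\<And>U. open U \<Longrightarrow> U \<noteq> {} \<Longrightarrow> \<exists>d\<in>Y. d \<in> U"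
      using countable_dense_exists by blast
    have xy: "AE \<omega> in M. defect_form a k \<omega> x y = 0" for x y
    proof (rule weighted_iterates_independent[OF standard fin free _ _ k])
      fix l assume l: "l \<in> R"
      have [simp]: "(\<lambda>\<omega>. x) \<in> L2 M" "(\<lambda>\<omega>. y) \<in> L2 M"
        by (auto simp: L2_def)
      show "integrable M (\<lambda>\<omega>. defect_form a l \<omega> x y)"
        using integrable_defect_form[OF a[OF l] a[OF symR[OF l]], of "\<lambda>\<omega>. x" "\<lambda>\<omega>. y"] by simp
    next
      fix Q C assume Q: "Q \<in> sets M" and C: "C \<in> sets M"
      let ?v = "\<lambda>\<omega>. indicator Q \<omega> *\<^sub>R x" and ?w = "\<lambda>\<omega>. indicator C \<omega> *\<^sub>R y"
      have L2: "?v \<in> L2 M" "?w \<in> L2 M" using Q C by (auto intro: indicator_L2)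
      have "defect_form a l \<omega> (?v (iter M \<theta> l \<omega>)) (?w \<omega>) =
          indicator Q (iter M \<theta> l \<omega>) * (indicator C \<omega> * defect_form a l \<omega> x y)" for l \<omega>
        by (simp add: defect_form_def blinfun.scaleR_right right_diff_distrib)
      moreover have "(\<integral>\<omega>. (\<Sum>l\<in>R. defect_form a l \<omega> (?v (iter M \<theta> l \<omega>)) (?w \<omega>)) \<partial>M) = 0"
        using defect[OF L2] sa L2 by (simp add: L2_self_adjoint_def)
      ultimately show "(\<integral>\<omega>. (\<Sum>l\<in>R. indicator Q (iter M \<theta> l \<omega>) *
          (indicator C \<omega> * defect_form a l \<omega> x y)) \<partial>M) = 0"
        by (simp only:)
    qed (use free in auto)
    have "AE \<omega> in M. \<forall>x\<in>Y. \<forall>y\<in>Y. defect_form a k \<omega> x y = 0"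
      using Y(1) xy by (intro AE_ball_countable') auto
    then show "AE \<omega> in M. blinfun_apply (a k \<omega>) = adjoint (a (- k) (iter M \<theta> k \<omega>))"
    proof eventually_elim
      case (elim \<omega>)
      have "defect_form a k \<omega> x y = 0" for x y
        by (rule defect_form_eq_zero_if_dense[OF Y(2)]) (use elim in auto)
      then have "adjoint (a (- k) (iter M \<theta> k \<omega>)) = blinfun_apply (a k \<omega>)"
        by (intro adjoint_unique) (simp add: defect_form_def inner_commute)
      then show ?case by simp
    qed
  qed
  show "L2_self_adjoint M D"
    if coeff: "\<forall>k\<in>R. AE \<omega> in M. blinfun_apply (a k \<omega>) = adjoint (a (- k) (iter M \<theta> k \<omega>))"
    unfolding L2_self_adjoint_def
  proof (intro conjI ballI D)
    fix v w :: "'w \<Rightarrow> 'h" assume v: "v \<in> L2 M" and w: "w \<in> L2 M"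
    have "AE \<omega> in M. \<forall>k\<in>R. blinfun_apply (a k \<omega>) = adjoint (a (- k) (iter M \<theta> k \<omega>))"
      using coeff fin by (intro AE_finite_allI) auto
    then have "AE \<omega> in M. (\<Sum>k\<in>R. defect_form a k \<omega> (v (iter M \<theta> k \<omega>)) (w \<omega>)) = 0"
    proof eventually_elim
      case (elim \<omega>)
      then have "defect_form a k \<omega> x y = 0" if "k \<in> R" for k x y
        using that inner_adjoint[of "a (- k) (iter M \<theta> k \<omega>)" y x]
        by (simp add: defect_form_def inner_commute)
      then show ?case by simp
    qed
    then have "(\<integral>\<omega>. (\<Sum>k\<in>R. defect_form a k \<omega> (v (iter M \<theta> k \<omega>)) (w \<omega>)) \<partial>M) = 0"
      by (rule integral_eq_zero_AE)
    then show "L2_inner M (D v) w = L2_inner M v (D w)"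
      using defect[OF v w] by simp
  qed
qed

end


section \<open>Potential memory fields\<close>

theorem theorem5p2:
  fixes M :: "'w measure"
    and \<theta> :: "'w \<Rightarrow> 'w"
    and S R :: "int set"
    and V :: "('w \<Rightarrow> 'h::{real_inner, banach, second_countable_topology}) set"
    and F :: "('w \<Rightarrow> 'h) \<Rightarrow> ('w \<Rightarrow> 'h)"
    and DF :: "('w \<Rightarrow> 'h) \<Rightarrow> ('w \<Rightarrow> 'h) \<Rightarrow> ('w \<Rightarrow> 'h)"
    and A :: "int \<Rightarrow> ('w \<Rightarrow> 'h) \<Rightarrow> 'w \<Rightarrow> ('h \<Rightarrow>\<^sub>L 'h)"
  assumes "standard_prob_space M"
    and "mp_automorphism M \<theta>"
    and "finite S"
    and R: "R = S \<union> uminus ` S"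
    and "seminorm_open (L2 M) (L2_norm M) V"
    and "convex V"
    and "regular_memory_field M \<theta> S V F DF A"
    and free: "\<And>k l. k \<in> R \<Longrightarrow> l \<in> R \<Longrightarrow> k \<noteq> l \<Longrightarrow>
           {\<omega> \<in> space M. iter M \<theta> k \<omega> = iter M \<theta> l \<omega>} \<in> null_sets M"
  shows "((\<exists>E. is_potential M V F E) \<longleftrightarrow> (\<forall>u\<in>V. L2_self_adjoint M (DF u))) \<and>
         ((\<forall>u\<in>V. L2_self_adjoint M (DF u)) \<longleftrightarrow>
            (\<forall>u\<in>V. \<forall>k\<in>R. AE \<omega> in M.
               blinfun_apply (A k u \<omega>) = adjoint (blinfun_apply (A (- k) u (iter M \<theta> k \<omega>))))) \<and>
         ((\<exists>E. is_potential M V F E) \<longrightarrow>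
            (\<forall>u0\<in>V. \<forall>C::real. is_potential M V F
               (\<lambda>u. C + integral {0..1} (\<lambda>t. L2_inner M (F (u0 + t *\<^sub>R (u - u0))) (u - u0)))))"
proof -
  note standard = assms(1) and conv = assms(6) and field = assms(7)
  interpret prob_space M using standard by (simp add: standard_prob_space_def)
  interpret automorphism M \<theta> by unfold_locales (rule assms(2))
  interpret L2: semi_inner "L2 M :: ('w \<Rightarrow> 'h) set" "L2_inner M" "L2_norm M"
    by (rule semi_inner_L2)
  interpret field: C1_field "L2 M :: ('w \<Rightarrow> 'h) set" "L2_inner M" "L2_norm M" V F DF
    by unfold_locales (use assms(5) field in \<open>auto simp: regular_memory_field_def\<close>)
  have potential_iff: "is_potential M V F E \<longleftrightarrow> field.has_gradient E" for E
    using field.gradient_C2 by (auto simp: is_potential_def field.has_gradient_def)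
  have symmetric_iff: "field.symmetric_derivative \<longleftrightarrow> (\<forall>u\<in>V. L2_self_adjoint M (DF u))"
    using field.derivative_bounded_op by (auto simp: field.symmetric_derivative_def L2_self_adjoint_def)
  have radial: "is_potential M V F (field.radial_potential u0 C)"
    if "field.symmetric_derivative" "u0 \<in> V" for u0 C
    using field.radial_potential_has_gradient[OF conv that] by (simp add: potential_iff)
  have symmetric_if: "field.symmetric_derivative" if "\<exists>E. is_potential M V F E"
    using that field.gradient_symmetric by (auto simp: potential_iff)
  have "\<exists>E. is_potential M V F E" if "field.symmetric_derivative"
  proof (cases "V = {}")
    case True
    \<comment> \<open>There is no base point for the line integral, but every functional is a potential.\<close>
    then show ?thesis unfolding potential_iff field.has_gradient_def by simp
  next
    case False
    then show ?thesis using radial[OF that] by blast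
  qed
  with symmetric_if symmetric_iff
  have potential: "(\<exists>E. is_potential M V F E) \<longleftrightarrow> (\<forall>u\<in>V. L2_self_adjoint M (DF u))" by blast
  have coefficients: "L2_self_adjoint M (DF u) \<longleftrightarrow>
      (\<forall>k\<in>R. AE \<omega> in M. blinfun_apply (A k u \<omega>) = adjoint (A (- k) u (iter M \<theta> k \<omega>)))"
    if u: "u \<in> V" for u
  proof (rule self_adjoint_iff_coefficients[OF standard])
    \<comment> \<open>The coefficients outside \<open>S\<close> vanish, so the sum may be extended to the symmetric set \<open>R\<close>.\<close>
    show fin: "finite R" using assms(3) by (simp add: R)
    show "- k \<in> R" if "k \<in> R" for k using that by (auto simp: R)
    have zero: "A k u = (\<lambda>\<omega>. 0)" if "k \<notin> S" for k
      using field u that by (auto simp: regular_memory_field_def)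
    show "A k u \<in> strong_Linf M" for k
    proof (cases "k \<in> S")
      case True
      then show ?thesis using field u by (auto simp: regular_memory_field_def)
    next
      case False
      then show ?thesis by (auto simp: zero strong_Linf_def intro: exI[of _ 0])
    qed
    show "bounded_op (L2 M) (L2_norm M) (L2 M) (L2_norm M) (DF u)"
      by (rule field.derivative_bounded_op[OF u])
    fix v :: "'w \<Rightarrow> 'h" assume v: "v \<in> L2 M"
    have "AE \<omega> in M. DF u v \<omega> = (\<Sum>k\<in>S. A k u \<omega> (v (iter M \<theta> k \<omega>)))"
      using field u v by (auto simp: regular_memory_field_def mult_op_def koopman_def)
    moreover have "(\<Sum>k\<in>S. A k u \<omega> (v (iter M \<theta> k \<omega>))) = (\<Sum>k\<in>R. A k u \<omega> (v (iter M \<theta> k \<omega>)))" for \<omega>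
      using fin by (intro sum.mono_neutral_left) (auto simp: R zero)
    ultimately show "AE \<omega> in M. DF u v \<omega> = (\<Sum>k\<in>R. A k u \<omega> (v (iter M \<theta> k \<omega>)))" by simp
  qed (use free in auto)
  have formula: "is_potential M V F
      (\<lambda>u. C + integral {0..1} (\<lambda>t. L2_inner M (F (u0 + t *\<^sub>R (u - u0))) (u - u0)))"
    if "\<exists>E. is_potential M V F E" "u0 \<in> V" for u0 C
    using radial[OF symmetric_if[OF that(1)] that(2), of C]
    by (simp add: field.radial_potential_def[abs_def])
  show ?thesis
  proof (intro conjI impI ballI allI)
    show "(\<forall>u\<in>V. L2_self_adjoint M (DF u)) \<longleftrightarrow>
        (\<forall>u\<in>V. \<forall>k\<in>R. AE \<omega> in M.
          blinfun_apply (A k u \<omega>) = adjoint (blinfun_apply (A (- k) u (iter M \<theta> k \<omega>))))"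
      by (rule ball_cong[OF refl coefficients])
    show "(\<exists>E. is_potential M V F E) \<longleftrightarrow> (\<forall>u\<in>V. L2_self_adjoint M (DF u))"
      by (rule potential)
    fix u0 and C :: real assume "\<exists>E. is_potential M V F E" "u0 \<in> V"
    then show "is_potential M V F
        (\<lambda>u. C + integral {0..1} (\<lambda>t. L2_inner M (F (u0 + t *\<^sub>R (u - u0))) (u - u0)))"
      by (rule formula)
  qed
qed

end
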